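(* Any two parameters in $\{\mathrm{d\text{-}nw},\mathrm{d\text{-}lnlcw},\mathrm{d\text{-}lcw},\mathrm{d\text{-}lrw}\}$ are equivalent: for any two of them $\alpha,\beta$ there exist functions $f_1,f_2:\mathbb N\to\mathbb N$ such that for every digraph $G$, $\alpha(G)\le f_1(\beta(G))$ and $\beta(G)\le f_2(\alpha(G))$.
   Context: Digraphs $G=(V,E)$ are finite with $E\subseteq\{(u,v):u\ne v\}$. A layout is a bijection $\varphi:V\to\{1,\dots,|V|\}$; $L(i,\varphi)=\{u:\varphi(u)\le i\}$, $R(i,\varphi)=\{u:\varphi(u)>i\}$. With $N_i(u)=(\{v\in R(i,\varphi):(u,v)\in E\},\{v\in R(i,\varphi):(v,u)\in E\})$, $\mathrm{d\text{-}nw}(G)=\min_\varphi\max_i|\{N_i(u):u\in L(i,\varphi)\}|$. $\mathrm{d\text{-}lnlcw}(G)$ is the least $k$ such that $G$ (under some labeling) is built from labeled digraphs with labels in $[k]$ by: $\bullet_a$ (a vertex labeled $a$); $H\otimes_{(\overrightarrow S,\overleftarrow S)}\bullet_a$ ($\overrightarrow S,\overleftarrow S\subseteq[k]^2$): add a new vertex $v$ labeled $a$ plus arcs $(u,v)$ for $u$ in $H$ of label $b$ with $(b,a)\in\overrightarrow S$ and arcs $(v,u)$ for $u$ in $H$ of label $b$ with $(b,a)\in\overleftarrow S$; $\circ_R$ ($R:[k]\to[k]$, relabel $a$ to $R(a)$). $\mathrm{d\text{-}lcw}(G)$ is the least number of labels to build $G$ with $\bullet_a$, $H\oplus\bullet_a$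 (add a new isolated vertex labeled $a$), $\alpha_{a,b}$ ($a\ne b$; add arcs from all label-$a$ to all label-$b$ vertices), $\rho_{a\to b}$ (relabel). $\mathrm{d\text{-}lrw}(G)$: minimum over pairs $(T,f)$, $T$ a caterpillar (a path with pendant vertices), $f$ a bijection from $V$ to the leaves of $T$, of the maximum over edges $e$ of $T$ (splitting $V$ into $A_e,B_e$) of the $GF(4)$-rank of the $A_e\times B_e$ matrix with entry $0$ (no arc between $x,y$), $\omega$ (only $(x,y)\in E$), $\omega^2$ (only $(y,x)\in E$), $1$ (both), where $GF(4)=\{0,1,\omega,\omega^2\}$.
   Formalization: In d-lrw the caterpillar T must have maximum degree 3; otherwise stars would give d-lrw ≤ 1 for every digraph and the claim would fail. f1, f2 are given for digraphs on a fixed vertex universe (e.g. ℕ, which covers all up to isomorphism); the empty digraph gets value 0. *)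

theory Defs
  imports "Graph_Theory.Graph_Theory" "HOL-Library.Function_Algebras"
begin

text \<open>
  Digraphs are records of type \<^typ>\<open>'a pair_pre_digraph\<close> satisfying \<open>pair_digraph\<close>
  (finite, loop-free, no parallel arcs). On the digraph without vertices, for which no
  expression and no caterpillar decomposition exists, all four parameters are set to \<open>0\<close>.
\<close>

section \<open>Directed neighbourhood-width\<close>

definition layout :: "'a pair_pre_digraph \<Rightarrow> ('a \<Rightarrow> nat) \<Rightarrow> bool" where
  "layout G \<phi> \<longleftrightarrow> bij_betw \<phi> (pverts G) {1..card (pverts G)}"

definition layout_left :: "'a pair_pre_digraph \<Rightarrow> ('a \<Rightarrow> nat) \<Rightarrow> nat \<Rightarrow> 'a set" where
  "layout_left G \<phi> i = {u \<in> pverts G. \<phi> u \<le> i}"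

definition layout_right :: "'a pair_pre_digraph \<Rightarrow> ('a \<Rightarrow> nat) \<Rightarrow> nat \<Rightarrow> 'a set" where
  "layout_right G \<phi> i = {u \<in> pverts G. \<phi> u > i}"

definition right_nbhd ::
  "'a pair_pre_digraph \<Rightarrow> ('a \<Rightarrow> nat) \<Rightarrow> nat \<Rightarrow> 'a \<Rightarrow> 'a set \<times> 'a set" where
  "right_nbhd G \<phi> i u =
     ({v \<in> layout_right G \<phi> i. (u, v) \<in> parcs G}, {v \<in> layout_right G \<phi> i. (v, u) \<in> parcs G})"

definition d_nw :: "'a pair_pre_digraph \<Rightarrow> nat" where
  "d_nw G = (INF \<phi> \<in> {\<phi>. layout G \<phi>}.
     SUP i \<in> {1..card (pverts G)}. card (right_nbhd G \<phi> i ` layout_left G \<phi> i))"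

section \<open>Directed linear NLC-width\<close>

text \<open>
  A labeled digraph is a pair of a digraph and a labeling; only the labels of vertices of the
  digraph are relevant, the values of the labeling elsewhere are arbitrary.
\<close>

inductive lnlc_graph :: "nat \<Rightarrow> 'a pair_pre_digraph \<Rightarrow> ('a \<Rightarrow> nat) \<Rightarrow> bool" for k where
  vertex: "a \<in> {1..k} \<Longrightarrow> lnlc_graph k \<lparr>pverts = {v}, parcs = {}\<rparr> (\<lambda>_. a)"
| join: "\<lbrakk>lnlc_graph k H lab; v \<notin> pverts H; a \<in> {1..k};
    S_fwd \<subseteq> {1..k} \<times> {1..k}; S_bwd \<subseteq> {1..k} \<times> {1..k}\<rbrakk> \<Longrightarrow>
    lnlc_graph k
      \<lparr>pverts = insert v (pverts H),
       parcs = parcs H \<union> {(u, v) |u. u \<in> pverts H \<and> (lab u, a) \<in> S_fwd}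
                       \<union> {(v, u) |u. u \<in> pverts H \<and> (lab u, a) \<in> S_bwd}\<rparr>
      (lab(v := a))"
| relabel: "\<lbrakk>lnlc_graph k H lab; R \<in> {1..k} \<rightarrow> {1..k}\<rbrakk> \<Longrightarrow> lnlc_graph k H (R \<circ> lab)"

definition d_lnlcw :: "'a pair_pre_digraph \<Rightarrow> nat" where
  "d_lnlcw G = (if pverts G = {} then 0 else LEAST k. \<exists>lab. lnlc_graph k G lab)"

section \<open>Directed linear clique-width\<close>

inductive lcw_graph :: "nat \<Rightarrow> 'a pair_pre_digraph \<Rightarrow> ('a \<Rightarrow> nat) \<Rightarrow> bool" for k where
  vertex: "a \<in> {1..k} \<Longrightarrow> lcw_graph k \<lparr>pverts = {v}, parcs = {}\<rparr> (\<lambda>_. a)"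
| add_vertex: "\<lbrakk>lcw_graph k H lab; v \<notin> pverts H; a \<in> {1..k}\<rbrakk> \<Longrightarrow>
    lcw_graph k \<lparr>pverts = insert v (pverts H), parcs = parcs H\<rparr> (lab(v := a))"
| add_arcs: "\<lbrakk>lcw_graph k H lab; a \<in> {1..k}; b \<in> {1..k}; a \<noteq> b\<rbrakk> \<Longrightarrow>
    lcw_graph k
      \<lparr>pverts = pverts H,
       parcs = parcs H \<union> {(u, w). u \<in> pverts H \<and> w \<in> pverts H \<and> lab u = a \<and> lab w = b}\<rparr>
      lab"
| relabel: "\<lbrakk>lcw_graph k H lab; a \<in> {1..k}; b \<in> {1..k}\<rbrakk> \<Longrightarrow>
    lcw_graph k H (\<lambda>u. if lab u = a then b else lab u)"

definition d_lcw :: "'a pair_pre_digraph \<Rightarrow> nat" where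
  "d_lcw G = (if pverts G = {} then 0 else LEAST k. \<exists>lab. lcw_graph k G lab)"

section \<open>The field with four elements\<close>

datatype gf4 = GF_zero | GF_one | GF_omega | GF_omega2

instantiation gf4 :: field
begin

definition zero_gf4 :: gf4 where "0 = GF_zero"
definition one_gf4 :: gf4 where "1 = GF_one"

fun plus_gf4 :: "gf4 \<Rightarrow> gf4 \<Rightarrow> gf4" where
  "GF_zero + y = y"
| "x + GF_zero = x"
| "GF_one + GF_one = GF_zero"
| "GF_one + GF_omega = GF_omega2"
| "GF_one + GF_omega2 = GF_omega"
| "GF_omega + GF_one = GF_omega2"
| "GF_omega + GF_omega = GF_zero"
| "GF_omega + GF_omega2 = GF_one"
| "GF_omega2 + GF_one = GF_omega"
| "GF_omega2 + GF_omega = GF_one"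
| "GF_omega2 + GF_omega2 = GF_zero"

definition uminus_gf4 :: "gf4 \<Rightarrow> gf4" where "- x = x" for x :: gf4
definition minus_gf4 :: "gf4 \<Rightarrow> gf4 \<Rightarrow> gf4" where "x - y = x + y" for x y :: gf4

fun times_gf4 :: "gf4 \<Rightarrow> gf4 \<Rightarrow> gf4" where
  "GF_zero * y = GF_zero"
| "GF_one * y = y"
| "GF_omega * GF_zero = GF_zero"
| "GF_omega * GF_one = GF_omega"
| "GF_omega * GF_omega = GF_omega2"
| "GF_omega * GF_omega2 = GF_one"
| "GF_omega2 * GF_zero = GF_zero"
| "GF_omega2 * GF_one = GF_omega2"
| "GF_omega2 * GF_omega = GF_one"
| "GF_omega2 * GF_omega2 = GF_omega"

fun inverse_gf4 :: "gf4 \<Rightarrow> gf4" where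
  "inverse GF_zero = GF_zero"
| "inverse GF_one = GF_one"
| "inverse GF_omega = GF_omega2"
| "inverse GF_omega2 = GF_omega"

definition divide_gf4 :: "gf4 \<Rightarrow> gf4 \<Rightarrow> gf4" where "x div y = x * inverse y" for x y :: gf4

instance
proof
  fix a b c :: gf4
  show "a + b + c = a + (b + c)" by (cases a; cases b; cases c) simp_all
  show "a + b = b + a" by (cases a; cases b) simp_all
  show "0 + a = a" by (simp add: zero_gf4_def)
  show "- a + a = 0" by (cases a) (simp_all add: zero_gf4_def uminus_gf4_def)
  show "a - b = a + - b" by (simp add: minus_gf4_def uminus_gf4_def)
  show "a * b * c = a * (b * c)" by (cases a; cases b; cases c) simp_all
  show "a * b = b * a" by (cases a; cases b) simp_all
  show "1 * a = a" by (simp add: one_gf4_def)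
  show "(a + b) * c = a * c + b * c" by (cases a; cases b; cases c) simp_all
  show "(0::gf4) \<noteq> 1" by (simp add: zero_gf4_def one_gf4_def)
  show "a \<noteq> 0 \<Longrightarrow> inverse a * a = 1" by (cases a) (simp_all add: zero_gf4_def one_gf4_def)
  show "a div b = a * inverse b" by (simp add: divide_gf4_def)
  show "inverse (0::gf4) = 0" by (simp add: zero_gf4_def)
qed

end

definition gf4_scale :: "gf4 \<Rightarrow> ('a \<Rightarrow> gf4) \<Rightarrow> 'a \<Rightarrow> gf4" where
  "gf4_scale c f = (\<lambda>x. c * f x)"

global_interpretation gf4_fun: vector_space "gf4_scale :: gf4 \<Rightarrow> ('a \<Rightarrow> gf4) \<Rightarrow> 'a \<Rightarrow> gf4"
  by unfold_locales (auto simp: gf4_scale_def fun_eq_iff algebra_simps)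

text \<open>
  The rank of the \<open>A \<times> B\<close> matrix \<open>M\<close> is the dimension of its row space; a row is represented
  as a vector indexed by the whole type that vanishes outside \<open>B\<close>.
\<close>

definition gf4_rank :: "'a set \<Rightarrow> 'a set \<Rightarrow> ('a \<Rightarrow> 'a \<Rightarrow> gf4) \<Rightarrow> nat" where
  "gf4_rank A B M = gf4_fun.dim ((\<lambda>x y. if y \<in> B then M x y else 0) ` A)"

section \<open>Directed linear rank-width\<close>

definition arc_matrix :: "'a pair_pre_digraph \<Rightarrow> 'a \<Rightarrow> 'a \<Rightarrow> gf4" where
  "arc_matrix G x y =
     (if (x, y) \<in> parcs G \<and> (y, x) \<in> parcs G then 1
      else if (x, y) \<in> parcs G then GF_omega
      else if (y, x) \<in> parcs G then GF_omega2
      else 0)"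

text \<open>
  Undirected graphs are symmetric digraphs. A caterpillar consists of a path with nodes \<open>p\<close> and
  pendant nodes, the pendant node \<open>x\<close> being attached to the path node \<open>g x\<close>.
\<close>

definition caterpillar :: "'b pair_pre_digraph \<Rightarrow> bool" where
  "caterpillar T \<longleftrightarrow> pair_graph T \<and>
     (\<exists>p g. p \<noteq> [] \<and> distinct p \<and> set p \<subseteq> pverts T \<and> g \<in> pverts T - set p \<rightarrow> set p \<and>
        (let F = {(p ! i, p ! Suc i) |i. Suc i < length p} \<union>
                 {(x, g x) |x. x \<in> pverts T - set p}
         in parcs T = F \<union> F\<inverse>))"

text \<open>
  Decomposition trees for rank-width are subcubic. Without this condition, stars would be
  admissible and every digraph would have width at most \<open>1\<close>.
\<close>

definition subcubic :: "'b pair_pre_digraph \<Rightarrow> bool" where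
  "subcubic T \<longleftrightarrow> (\<forall>x \<in> pverts T. out_degree (with_proj T) x \<le> 3)"

text \<open>The degree bound \<open>\<le> 1\<close> makes the node of a one-node tree a leaf.\<close>

definition leaves :: "'b pair_pre_digraph \<Rightarrow> 'b set" where
  "leaves T = {x \<in> pverts T. out_degree (with_proj T) x \<le> 1}"

definition del_edge :: "'b pair_pre_digraph \<Rightarrow> 'b \<Rightarrow> 'b \<Rightarrow> 'b pair_pre_digraph" where
  "del_edge T s t = T\<lparr>parcs := parcs T - {(s, t), (t, s)}\<rparr>"

text \<open>The vertices of \<open>G\<close> mapped by \<open>f\<close> to the component containing \<open>s\<close> of \<open>T\<close> minus the edge \<open>st\<close>.\<close>

definition edge_side ::
  "'a pair_pre_digraph \<Rightarrow> 'b pair_pre_digraph \<Rightarrow> ('a \<Rightarrow> 'b) \<Rightarrow> 'b \<Rightarrow> 'b \<Rightarrow> 'a set" where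
  "edge_side G T f s t = {v \<in> pverts G. reachable (with_proj (del_edge T s t)) s (f v)}"

text \<open>
  The supremum ranges over both orientations of each edge; exchanging \<open>s\<close> and \<open>t\<close> transposes the
  matrix and applies the Frobenius automorphism to its entries, which does not change the rank.
\<close>

definition decomp_width ::
  "'a pair_pre_digraph \<Rightarrow> 'b pair_pre_digraph \<Rightarrow> ('a \<Rightarrow> 'b) \<Rightarrow> nat" where
  "decomp_width G T f =
     (SUP (s, t) \<in> parcs T. gf4_rank (edge_side G T f s t) (edge_side G T f t s) (arc_matrix G))"

definition d_lrw :: "'a pair_pre_digraph \<Rightarrow> nat" where
  "d_lrw G = (if pverts G = {} then 0
     else INF (T, f) \<in> {(T :: nat pair_pre_digraph, f).
            caterpillar T \<and> subcubic T \<and> bij_betw f (pverts G) (leaves T)}. decomp_width G T f)"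

end

theory Submission
  imports Defs
begin

text \<open>
  All parameters are compared with the neighbourhood-width of a linear order of the vertices. The
  order of insertion of an expression has at most as many neighbourhood classes across each cut as
  there are labels. Conversely, a linear order with \<open>k\<close> classes across each cut yields an
  NLC-expression in which the labels are the classes, one more label being reserved for the vertex
  just inserted. A linear order is turned into a comb-shaped caterpillar, and a caterpillar into a
  linear order by sorting the vertices along the path; since \<open>GF(4)\<close> is finite, a matrix of rank
  \<open>r\<close> has at most \<open>4^r\<close> distinct rows, and the rank is at most the number of distinct rows.
\<close>

text \<open>\<open>d_nw\<close> is the hub: every parameter bounds it and is bounded by it, so any
  two are related by composing two bounds. The loss is linear for the two expression widths and
  exponential for \<open>d_lrw\<close>. Clique-width expressions are obtained from an order by way
  of NLC-expressions. On the side of expressions the obstacle is that relabelling may merge labels,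
  so the final labels say nothing about earlier cuts. For each cut the invariant therefore keeps a
  colouring frozen at the moment when the left side of the cut was complete. On the side of trees
  the obstacle is that several leaves may belong to the same path node, and then no path edge
  realises a cut of the order that runs between them. Subcubicity leaves at most 4 tree nodes there,
  which is the origin of the additive 4. Rank bounds and class counts are monotone in the two sides
  of a cut. Hence inclusions for the sides of a tree edge suffice: upper bounds for the comb, lower
  bounds for an arbitrary caterpillar.\<close>

lemma SUP_nat_le_iff:
  fixes f :: "'i \<Rightarrow> nat"
  assumes "finite I"
  shows "(SUP i\<in>I. f i) \<le> k \<longleftrightarrow> (\<forall>i\<in>I. f i \<le> k)"
proof (cases "I = {}")
  case False
  then show ?thesis using assms by (subst cSup_eq_Max) auto
qed simp

text \<open>A nonempty infimum of naturals is attained; this turns bounds on \<open>d_nw\<close> and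
  \<open>d_lrw\<close> into witnesses.\<close>

lemma INF_nat_le_iff:
  fixes f :: "'i \<Rightarrow> nat"
  assumes "A \<noteq> {}"
  shows "(INF x\<in>A. f x) \<le> k \<longleftrightarrow> (\<exists>x\<in>A. f x \<le> k)"
proof
  assume "(INF x\<in>A. f x) \<le> k"
  moreover have "(INF x\<in>A. f x) \<in> f ` A" using assms by (intro Inf_nat_def1) auto
  ultimately show "\<exists>x\<in>A. f x \<le> k" by auto
next
  assume "\<exists>x\<in>A. f x \<le> k"
  then obtain x where "x \<in> A" "f x \<le> k" by blast
  then show "(INF x\<in>A. f x) \<le> k" by (meson cINF_lower bdd_below_bot order_trans)
qed

text \<open>\<open>f\<close> factors through \<open>c\<close> on \<open>A\<close>. It is used with
  \<open>c\<close> a colouring, a cut neighbourhood or a matrix row.\<close>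

lemma card_image_le_of_factor:
  assumes "finite A" "c ` A \<subseteq> C" "finite C" "\<And>x y. x \<in> A \<Longrightarrow> y \<in> A \<Longrightarrow> c x = c y \<Longrightarrow> f x = f y"
  shows "card (f ` A) \<le> card C"
proof -
  have "card (f ` A) \<le> card (c ` A)"
  proof (rule surj_card_le)
    show "finite (c ` A)" using assms(1) by simp
    show "f ` A \<subseteq> (\<lambda>b. f (SOME x. x \<in> A \<and> c x = b)) ` c ` A"
    proof
      fix y assume "y \<in> f ` A"
      then obtain x where x: "x \<in> A" "y = f x" by blast
      have "(SOME z. z \<in> A \<and> c z = c x) \<in> A \<and> c (SOME z. z \<in> A \<and> c z = c x) = c x"
        by (rule someI[of _ x]) (simp add: x)
      then have "f (SOME z. z \<in> A \<and> c z = c x) = y" using assms(4) x by metis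
      then show "y \<in> (\<lambda>b. f (SOME x. x \<in> A \<and> c x = b)) ` c ` A" using x by blast
    qed
  qed
  also have "\<dots> \<le> card C" using assms by (intro card_mono)
  finally show ?thesis .
qed

section \<open>Linear orders of bounded neighbourhood-width\<close>

text \<open>This is \<open>right_nbhd\<close> with an arbitrary set as right side, so that cuts of
  lists need no layout.\<close>

definition cut_nbhd :: "'a pair_pre_digraph \<Rightarrow> 'a set \<Rightarrow> 'a \<Rightarrow> 'a set \<times> 'a set" where
  "cut_nbhd G Z u = ({v \<in> Z. (u, v) \<in> parcs G}, {v \<in> Z. (v, u) \<in> parcs G})"

lemma cut_nbhd_eq_iff:
  "cut_nbhd G Z u = cut_nbhd G Z u' \<longleftrightarrow>
     (\<forall>z\<in>Z. ((u, z) \<in> parcs G \<longleftrightarrow> (u', z) \<in> parcs G) \<and> ((z, u) \<in> parcs G \<longleftrightarrow> (z, u') \<in> parcs G))"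
  unfolding cut_nbhd_def by blast

definition nw_order :: "'a pair_pre_digraph \<Rightarrow> nat \<Rightarrow> 'a list \<Rightarrow> bool" where
  "nw_order G k xs \<longleftrightarrow> distinct xs \<and> set xs = pverts G \<and>
     (\<forall>i \<le> length xs. card (cut_nbhd G (set (drop i xs)) ` set (take i xs)) \<le> k)"

text \<open>List positions start at 0 and layout values at 1; with the shift by \<open>Suc\<close>,
  the cut at \<open>i\<close> is the split into \<open>take i\<close> and
  \<open>drop i\<close>.\<close>

lemma layout_of_list:
  assumes "distinct xs" "set xs = pverts G" "\<And>i. i < length xs \<Longrightarrow> \<phi> (xs ! i) = Suc i"
  shows "layout G \<phi>" "layout_left G \<phi> i = set (take i xs)" "layout_right G \<phi> i = set (drop i xs)"
proof -
  have n: "card (pverts G) = length xs" using assms distinct_card by metis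
  have *: "bij_betw ((!) xs) {..<length xs} (pverts G)"
    using assms bij_betw_nth[of xs] by blast
  have "bij_betw (\<phi> \<circ> (!) xs) {..<length xs} {1..length xs}"
  proof (rule bij_betw_cong[THEN iffD2])
    show "(\<phi> \<circ> (!) xs) i = Suc i" if "i \<in> {..<length xs}" for i using assms(3) that by simp
    show "bij_betw Suc {..<length xs} {1..length xs}"
      by (auto simp: bij_betw_def lessThan_atLeast0 image_Suc_atLeastLessThan)
  qed
  then show "layout G \<phi>"
    unfolding layout_def n using bij_betw_comp_iff[OF *] by blast
  have mem: "u \<in> pverts G \<longleftrightarrow> (\<exists>j<length xs. u = xs ! j)" for u
    using assms(2) by (metis in_set_conv_nth)
  show "layout_left G \<phi> i = set (take i xs)"
    unfolding layout_left_def using assms(3) by (fastforce simp: mem in_set_conv_nth)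
  show "layout_right G \<phi> i = set (drop i xs)"
  proof (intro set_eqI iffI)
    fix u assume "u \<in> layout_right G \<phi> i"
    then obtain j where "j < length xs" "u = xs ! j" "i \<le> j"
      unfolding layout_right_def using assms(3) by (fastforce simp: mem)
    then have "u = drop i xs ! (j - i)" "j - i < length (drop i xs)" by auto
    then show "u \<in> set (drop i xs)" by (metis nth_mem)
  next
    fix u assume "u \<in> set (drop i xs)"
    then obtain j where "j < length xs - i" "u = xs ! (i + j)"
      by (auto simp: in_set_conv_nth)
    then have "i + j < length xs" "u = xs ! (i + j)" by auto
    then show "u \<in> layout_right G \<phi> i"
      unfolding layout_right_def using assms(3)[of "i + j"] by (auto simp: mem)
  qed
qed

text \<open>A layout is listed by its inverse, and a list is turned into a layout by its
  positions.\<close>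

lemma d_nw_le_iff_nw_order:
  assumes "finite (pverts G)"
  shows "d_nw G \<le> k \<longleftrightarrow> (\<exists>xs. nw_order G k xs)"
proof -
  define n where "n = card (pverts G)"
  obtain ys where ys: "set ys = pverts G" "distinct ys" using assms finite_distinct_list by blast
  have ex: "\<exists>\<phi>. \<forall>i<length xs. \<phi> (xs ! i) = Suc i" if "distinct xs" for xs :: "'a list"
  proof -
    have "inj_on ((!) xs) {..<length xs}" using that by (auto simp: inj_on_nth)
    then show ?thesis
      by (intro exI[of _ "\<lambda>v. Suc (inv_into {..<length xs} ((!) xs) v)"]) (simp add: inv_into_f_f)
  qed
  have nb: "right_nbhd G \<phi> i = cut_nbhd G (layout_right G \<phi> i)" for \<phi> i
    by (simp add: fun_eq_iff right_nbhd_def cut_nbhd_def)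
  \<comment> \<open>Some layout exists, so the infimum in \<open>d_nw\<close> is attained.\<close>
  have "{\<phi>. layout G \<phi>} \<noteq> {}" using ex[OF ys(2)] layout_of_list(1)[OF ys(2,1)] by blast
  then have "d_nw G \<le> k \<longleftrightarrow> (\<exists>\<phi>. layout G \<phi> \<and>
      (\<forall>i\<in>{1..n}. card (cut_nbhd G (layout_right G \<phi> i) ` layout_left G \<phi> i) \<le> k))"
    unfolding d_nw_def by (simp add: INF_nat_le_iff SUP_nat_le_iff n_def nb)
  also have "\<dots> \<longleftrightarrow> (\<exists>xs. nw_order G k xs)"
  proof
    assume "\<exists>\<phi>. layout G \<phi> \<and>
      (\<forall>i\<in>{1..n}. card (cut_nbhd G (layout_right G \<phi> i) ` layout_left G \<phi> i) \<le> k)"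
    then obtain \<phi> where bij: "bij_betw \<phi> (pverts G) {1..n}"
      and le: "\<And>i. i \<in> {1..n} \<Longrightarrow> card (cut_nbhd G (layout_right G \<phi> i) ` layout_left G \<phi> i) \<le> k"
      unfolding layout_def n_def by blast
    define xs where "xs = map (inv_into (pverts G) \<phi>) [1..<Suc n]"
    have inv: "bij_betw (inv_into (pverts G) \<phi>) {1..n} (pverts G)"
      using bij by (rule bij_betw_inv_into)
    have xs: "distinct xs" "set xs = pverts G" "length xs = n"
      using inv by (auto simp: xs_def distinct_map bij_betw_def atLeastLessThanSuc_atLeastAtMost
          simp del: upt_Suc)
    have "\<phi> (xs ! i) = Suc i" if "i < length xs" for i
      using that bij xs(3)
      by (auto simp: xs_def bij_betw_def simp del: upt_Suc intro!: f_inv_into_f)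
    note lay = layout_of_list[OF xs(1,2) this]
    have "card (cut_nbhd G (set (drop i xs)) ` set (take i xs)) \<le> k" if "i \<le> length xs" for i
    \<comment> \<open>Layout cuts start at 1; the extra cut at 0 has an empty left side.\<close>
    proof (cases "i = 0")
      case False
      then show ?thesis using le[of i] that xs(3) lay by auto
    qed simp
    then show "\<exists>xs. nw_order G k xs" unfolding nw_order_def using xs by blast
  next
    assume "\<exists>xs. nw_order G k xs"
    then obtain xs where xs: "distinct xs" "set xs = pverts G"
      "\<And>i. i \<le> length xs \<Longrightarrow> card (cut_nbhd G (set (drop i xs)) ` set (take i xs)) \<le> k"
      unfolding nw_order_def by blast
    obtain \<phi> where \<phi>: "\<And>i. i < length xs \<Longrightarrow> \<phi> (xs ! i) = Suc i" using ex[OF xs(1)] by blast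
    note lay = layout_of_list[OF xs(1,2) \<phi>]
    have "length xs = n" using xs unfolding n_def by (metis distinct_card)
    then show "\<exists>\<phi>. layout G \<phi> \<and>
      (\<forall>i\<in>{1..n}. card (cut_nbhd G (layout_right G \<phi> i) ` layout_left G \<phi> i) \<le> k)"
      using xs(3) lay by (intro exI[of _ \<phi>]) auto
  qed
  finally show ?thesis .
qed

section \<open>Linear NLC- and clique-width expressions\<close>

text \<open>In the invariant below, \<open>c\<close> records the labels at the moment when
  \<open>Y\<close> was completed. Agreement of the current labels is included because later
  operations see vertices only through them.\<close>

definition cut_coloring ::
  "nat \<Rightarrow> 'a pair_pre_digraph \<Rightarrow> ('a \<Rightarrow> nat) \<Rightarrow> 'a set \<Rightarrow> 'a set \<Rightarrow> ('a \<Rightarrow> nat) \<Rightarrow> bool" where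
  "cut_coloring k H lab Y Z c \<longleftrightarrow> c ` Y \<subseteq> {1..k} \<and>
     (\<forall>u\<in>Y. \<forall>u'\<in>Y. c u = c u' \<longrightarrow> lab u = lab u' \<and> cut_nbhd H Z u = cut_nbhd H Z u')"

text \<open>The colouring itself stays fixed: an operation preserves it as soon as it does not
  separate vertices that agree in label and cut neighbourhood.\<close>

lemma cut_coloring_mono:
  assumes "cut_coloring k H lab Y Z c"
    and "\<And>u u'. u \<in> Y \<Longrightarrow> u' \<in> Y \<Longrightarrow> lab u = lab u' \<Longrightarrow> cut_nbhd H Z u = cut_nbhd H Z u' \<Longrightarrow>
      lab' u = lab' u' \<and> cut_nbhd H' Z' u = cut_nbhd H' Z' u'"
  shows "cut_coloring k H' lab' Y Z' c"
  unfolding cut_coloring_def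
proof (intro conjI ballI impI)
  show "c ` Y \<subseteq> {1..k}" using assms(1) unfolding cut_coloring_def by (rule conjunct1)
  fix u u' assume u: "u \<in> Y" "u' \<in> Y" "c u = c u'"
  then have "lab u = lab u' \<and> cut_nbhd H Z u = cut_nbhd H Z u'"
    using assms(1) unfolding cut_coloring_def by meson
  then show "lab' u = lab' u'" "cut_nbhd H' Z' u = cut_nbhd H' Z' u'"
    using assms(2)[OF u(1,2)] by blast+
qed

text \<open>
  Vertices that carry the same label at some point are treated alike from then on, which makes this
  an invariant of both kinds of expressions.
\<close>

definition label_order :: "nat \<Rightarrow> 'a pair_pre_digraph \<Rightarrow> ('a \<Rightarrow> nat) \<Rightarrow> 'a list \<Rightarrow> bool" where
  "label_order k H lab xs \<longleftrightarrow> distinct xs \<and> set xs = pverts H \<and>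
     parcs H \<subseteq> pverts H \<times> pverts H \<and> lab ` pverts H \<subseteq> {1..k} \<and>
     (\<forall>i \<le> length xs. \<exists>c. cut_coloring k H lab (set (take i xs)) (set (drop i xs)) c)"

lemma nw_order_if_label_order:
  assumes "label_order k H lab xs"
  shows "nw_order H k xs"
proof -
  have "card (cut_nbhd H (set (drop i xs)) ` set (take i xs)) \<le> k" if "i \<le> length xs" for i
  proof -
    obtain c where "cut_coloring k H lab (set (take i xs)) (set (drop i xs)) c"
      using assms \<open>i \<le> length xs\<close> unfolding label_order_def by blast
    then have c: "c ` set (take i xs) \<subseteq> {1..k}"
      "\<And>u u'. u \<in> set (take i xs) \<Longrightarrow> u' \<in> set (take i xs) \<Longrightarrow> c u = c u' \<Longrightarrow>
         cut_nbhd H (set (drop i xs)) u = cut_nbhd H (set (drop i xs)) u'"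
      unfolding cut_coloring_def by (blast, meson)
    show ?thesis using card_image_le_of_factor[OF _ c(1) _ c(2)] by simp
  qed
  then show ?thesis using assms unfolding label_order_def nw_order_def by simp
qed

lemma label_order_vertex:
  assumes "a \<in> {1..k}"
  shows "label_order k \<lparr>pverts = {v}, parcs = {}\<rparr> (\<lambda>_. a) [v]"
proof -
  have "cut_coloring k \<lparr>pverts = {v}, parcs = {}\<rparr> (\<lambda>_. a) Y Z (\<lambda>_. a)" for Y Z
    using assms by (simp add: cut_coloring_def cut_nbhd_def image_subset_iff)
  then show ?thesis using assms unfolding label_order_def by auto
qed

text \<open>The arcs at the new vertex depend only on labels, so old colourings survive. The
  predicates \<open>P\<close> and \<open>Q\<close> cover both the NLC-join and, with both false, the
  insertion of an isolated vertex.\<close>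

lemma label_order_extend:
  assumes ord: "label_order k H lab xs" and v: "v \<notin> pverts H" and a: "a \<in> {1..k}"
    and H': "pverts H' = insert v (pverts H)"
      "parcs H' = parcs H \<union> {(u, v) |u. u \<in> pverts H \<and> P (lab u)}
                         \<union> {(v, u) |u. u \<in> pverts H \<and> Q (lab u)}"
  shows "label_order k H' (lab(v := a)) (xs @ [v])"
proof -
  have xs: "distinct xs" "set xs = pverts H" and wf: "parcs H \<subseteq> pverts H \<times> pverts H"
    and lab: "lab ` pverts H \<subseteq> {1..k}"
    and cl: "\<And>i. i \<le> length xs \<Longrightarrow> \<exists>c. cut_coloring k H lab (set (take i xs)) (set (drop i xs)) c"
    using ord unfolding label_order_def by simp_all
  have "\<exists>c. cut_coloring k H' (lab(v := a)) (set (take i (xs @ [v]))) (set (drop i (xs @ [v]))) c"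
    if i: "i \<le> length (xs @ [v])" for i
  proof (cases "i = length (xs @ [v])")
    case True
    \<comment> \<open>Nothing lies to the right of the full list, so all cut neighbourhoods are
      empty and the current labels serve as the new frozen colouring.\<close>
    then show ?thesis using lab a v xs
      by (intro exI[of _ "lab(v := a)"]) (auto simp: cut_coloring_def cut_nbhd_def)
  next
    case False
    then have i: "i \<le> length xs" using i by simp
    have sub: "set (take i xs) \<subseteq> pverts H" "set (drop i xs) \<subseteq> pverts H"
      using xs(2) set_take_subset set_drop_subset by metis+
    obtain c where c: "cut_coloring k H lab (set (take i xs)) (set (drop i xs)) c"
      using cl[OF i] by (rule exE)
    have "cut_coloring k H' (lab(v := a)) (set (take i xs)) (insert v (set (drop i xs))) c"
    proof (rule cut_coloring_mono[OF c])
      fix u u'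
      assume u: "u \<in> set (take i xs)" "u' \<in> set (take i xs)" "lab u = lab u'"
        "cut_nbhd H (set (drop i xs)) u = cut_nbhd H (set (drop i xs)) u'"
      then have "u \<in> pverts H" "u' \<in> pverts H" "u \<noteq> v" "u' \<noteq> v" using sub v by auto
      moreover have "z \<in> pverts H" "z \<noteq> v" if "z \<in> set (drop i xs)" for z
        using that sub v by auto
      \<comment> \<open>The fresh \<open>v\<close> has no arcs in \<open>H\<close>, so adjacency to
        it is decided by \<open>P\<close> and \<open>Q\<close> alone.\<close>
      moreover have "(v, z) \<notin> parcs H" "(z, v) \<notin> parcs H" for z using wf v by auto
      ultimately show "(lab(v := a)) u = (lab(v := a)) u' \<and>
          cut_nbhd H' (insert v (set (drop i xs))) u = cut_nbhd H' (insert v (set (drop i xs))) u'"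
        using u(3,4) unfolding cut_nbhd_eq_iff H' by simp
    qed
    then show ?thesis using i by auto
  qed
  moreover have "parcs H' \<subseteq> pverts H' \<times> pverts H'" using wf by (auto simp: H')
  moreover have "(lab(v := a)) ` pverts H' \<subseteq> {1..k}" using lab a v by (auto simp: H')
  ultimately show ?thesis
    unfolding label_order_def using xs v by (simp add: H')
qed

lemma label_order_relabel:
  assumes "label_order k H lab xs" "(\<lambda>u. R (lab u)) ` pverts H \<subseteq> {1..k}"
  shows "label_order k H (\<lambda>u. R (lab u)) xs"
proof -
  have "cut_coloring k H (\<lambda>u. R (lab u)) Y Z c" if "cut_coloring k H lab Y Z c" for Y Z c
    using that by (rule cut_coloring_mono) simp
  then show ?thesis using assms unfolding label_order_def by meson
qed

text \<open>Equally labelled vertices on the left gain the same arcs across the cut.\<close>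

lemma label_order_add_arcs:
  assumes ord: "label_order k H lab xs"
  shows "label_order k
      \<lparr>pverts = pverts H,
       parcs = parcs H \<union> {(u, w). u \<in> pverts H \<and> w \<in> pverts H \<and> lab u = a \<and> lab w = b}\<rparr> lab xs"
    (is "label_order k ?H lab xs")
proof -
  have xs: "set xs = pverts H" using ord unfolding label_order_def by simp
  have "cut_coloring k ?H lab (set (take i xs)) (set (drop i xs)) c"
    if "cut_coloring k H lab (set (take i xs)) (set (drop i xs)) c" for i c
    using that
  proof (rule cut_coloring_mono)
    fix u u'
    assume u: "u \<in> set (take i xs)" "u' \<in> set (take i xs)" "lab u = lab u'"
      "cut_nbhd H (set (drop i xs)) u = cut_nbhd H (set (drop i xs)) u'"
    have "u \<in> pverts H" "u' \<in> pverts H" using u(1,2) xs by (auto dest: in_set_takeD)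
    then show "lab u = lab u' \<and>
        cut_nbhd ?H (set (drop i xs)) u = cut_nbhd ?H (set (drop i xs)) u'"
      using u(3,4) unfolding cut_nbhd_eq_iff by simp
  qed
  moreover have "parcs ?H \<subseteq> pverts ?H \<times> pverts ?H"
    using ord unfolding label_order_def by auto
  ultimately show ?thesis using ord unfolding label_order_def
    by (simp only: pair_pre_digraph.select_convs) meson
qed

lemma lnlc_graph_label_order: "lnlc_graph k H lab \<Longrightarrow> \<exists>xs. label_order k H lab xs"
proof (induction rule: lnlc_graph.induct)
  case (vertex a v)
  then show ?case by (intro exI) (rule label_order_vertex)
next
  case (join H lab v a S_fwd S_bwd)
  then obtain xs where "label_order k H lab xs" by blast
  note label_order_extend[OF this join.hyps(2,3),
      where P = "\<lambda>b. (b, a) \<in> S_fwd" and Q = "\<lambda>b. (b, a) \<in> S_bwd"]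
  then show ?case by (rule exI) simp_all
next
  case (relabel H lab R)
  then obtain xs where xs: "label_order k H lab xs" by blast
  moreover have "(\<lambda>u. R (lab u)) ` pverts H \<subseteq> {1..k}"
    using relabel.hyps(2) xs unfolding label_order_def by (simp add: Pi_iff image_subset_iff)
  ultimately show ?case unfolding comp_def using label_order_relabel by blast
qed

lemma lcw_graph_label_order: "lcw_graph k H lab \<Longrightarrow> \<exists>xs. label_order k H lab xs"
proof (induction rule: lcw_graph.induct)
  case (vertex a v)
  then show ?case by (intro exI) (rule label_order_vertex)
next
  case (add_vertex H lab v a)
  then obtain xs where "label_order k H lab xs" by blast
  note label_order_extend[OF this add_vertex.hyps(2,3),
      where P = "\<lambda>_. False" and Q = "\<lambda>_. False"]
  then show ?case by (rule exI) simp_all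
next
  case (add_arcs H lab a b)
  then show ?case using label_order_add_arcs by blast
next
  case (relabel H lab a b)
  then obtain xs where xs: "label_order k H lab xs" by blast
  moreover have "(\<lambda>u. if lab u = a then b else lab u) ` pverts H \<subseteq> {1..k}"
    using relabel.hyps(3) xs unfolding label_order_def by auto
  ultimately show ?case
    using label_order_relabel[where R = "\<lambda>l. if l = a then b else l"] by blast
qed

section \<open>NLC-expressions from linear orders\<close>

definition induced :: "'a pair_pre_digraph \<Rightarrow> 'a set \<Rightarrow> 'a pair_pre_digraph" where
  "induced G A = \<lparr>pverts = A, parcs = parcs G \<inter> A \<times> A\<rparr>"

lemma induced_pverts: "pair_digraph G \<Longrightarrow> induced G (pverts G) = G"
  unfolding induced_def
  by (rule pair_pre_digraph.equality)
    (auto dest: pair_wf_digraph.in_arcsD1 pair_wf_digraph.in_arcsD2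
      simp: pair_digraph_def pair_fin_digraph_def)

text \<open>By \<open>same\<close>, the label of an old vertex decides its arcs to and from
  \<open>v\<close>; the two sets of the join are read off from these arcs.\<close>

lemma lnlc_graph_join_induced:
  assumes "lnlc_graph k (induced G A) lab" "v \<notin> A" "a \<in> {1..k}" "lab ` A \<subseteq> {1..k}"
    and "(v, v) \<notin> parcs G"
    and same: "\<And>u u'. u \<in> A \<Longrightarrow> u' \<in> A \<Longrightarrow> lab u = lab u' \<Longrightarrow>
      ((u, v) \<in> parcs G \<longleftrightarrow> (u', v) \<in> parcs G) \<and> ((v, u) \<in> parcs G \<longleftrightarrow> (v, u') \<in> parcs G)"
  shows "lnlc_graph k (induced G (insert v A)) (lab(v := a))"
proof -
  define Sf where "Sf = {(lab u, a) |u. u \<in> A \<and> (u, v) \<in> parcs G}"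
  define Sb where "Sb = {(lab u, a) |u. u \<in> A \<and> (v, u) \<in> parcs G}"
  have mem: "(lab u, a) \<in> Sf \<longleftrightarrow> (u, v) \<in> parcs G" "(lab u, a) \<in> Sb \<longleftrightarrow> (v, u) \<in> parcs G"
    if "u \<in> A" for u
    using same that unfolding Sf_def Sb_def by blast+
  have "Sf \<subseteq> {1..k} \<times> {1..k}" "Sb \<subseteq> {1..k} \<times> {1..k}"
    using assms(3,4) unfolding Sf_def Sb_def by auto
  then have "lnlc_graph k
      \<lparr>pverts = insert v (pverts (induced G A)),
       parcs = parcs (induced G A) \<union> {(u, v) |u. u \<in> pverts (induced G A) \<and> (lab u, a) \<in> Sf}
                       \<union> {(v, u) |u. u \<in> pverts (induced G A) \<and> (lab u, a) \<in> Sb}\<rparr>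
      (lab(v := a))"
    using assms(1-3) by (intro lnlc_graph.join) (simp_all add: induced_def)
  also have "\<lparr>pverts = insert v (pverts (induced G A)),
       parcs = parcs (induced G A) \<union> {(u, v) |u. u \<in> pverts (induced G A) \<and> (lab u, a) \<in> Sf}
                       \<union> {(v, u) |u. u \<in> pverts (induced G A) \<and> (lab u, a) \<in> Sb}\<rparr>
      = induced G (insert v A)"
    using assms(5) mem by (auto simp: induced_def)
  finally show ?thesis .
qed

text \<open>Each label determines a class of \<open>N\<close>, so sending labels to numbered classes
  is a legitimate relabelling. It compresses the labels from \<open>m\<close> to
  \<open>k\<close>.\<close>

lemma lnlc_graph_relabel_classes:
  fixes lab :: "'a \<Rightarrow> nat"
  assumes "lnlc_graph m H lab" "finite A" "card (N ` A) \<le> k" "k \<le> m" "1 \<le> m"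
    and "\<And>u u'. u \<in> A \<Longrightarrow> u' \<in> A \<Longrightarrow> lab u = lab u' \<Longrightarrow> N u = N u'"
  shows "\<exists>lab'. lnlc_graph m H lab' \<and> lab' ` A \<subseteq> {1..k} \<and>
    (\<forall>u\<in>A. \<forall>u'\<in>A. lab' u = lab' u' \<longrightarrow> N u = N u')"
proof -
  obtain h where h: "h ` N ` A \<subseteq> {1..k}" "inj_on h (N ` A)"
    using card_le_inj[of "N ` A" "{1..k}"] assms(2,3) by auto
  \<comment> \<open>A relabelling must map all of \<open>{1..m}\<close> into itself; labels absent
    from \<open>A\<close> get the default 1.\<close>
  define R where "R l = (if l \<in> lab ` A then h (N (SOME u. u \<in> A \<and> lab u = l)) else 1)" for l
  have R: "R (lab u) = h (N u)" if "u \<in> A" for u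
  proof -
    have "(SOME w. w \<in> A \<and> lab w = lab u) \<in> A \<and> lab (SOME w. w \<in> A \<and> lab w = lab u) = lab u"
      by (rule someI[of _ u]) (simp add: that)
    then have "N (SOME w. w \<in> A \<and> lab w = lab u) = N u" using assms(6) that by blast
    then show ?thesis using that by (simp add: R_def)
  qed
  have "R l \<in> {1..m}" for l
  proof (cases "l \<in> lab ` A")
    case True
    then obtain u where "u \<in> A" "l = lab u" by blast
    then show ?thesis using R[of u] h(1) assms(4) by fastforce
  next
    case False
    then show ?thesis using assms(5) by (simp add: R_def)
  qed
  then have "lnlc_graph m H (R \<circ> lab)" using assms(1) by (intro lnlc_graph.relabel) auto
  moreover have "(R \<circ> lab) ` A \<subseteq> {1..k}" using R h(1) by auto
  moreover have "\<forall>u\<in>A. \<forall>u'\<in>A. (R \<circ> lab) u = (R \<circ> lab) u' \<longrightarrow> N u = N u'"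
    using R h(2) by (auto simp: inj_on_eq_iff)
  ultimately show ?thesis by blast
qed

text \<open>Between insertions only the labels up to \<open>k\<close> are in use, and each
  determines the neighbourhood across the current cut. Label \<open>Suc k\<close> holds the new
  vertex apart until the classes of the next cut are known.\<close>

lemma lnlc_graph_if_nw_order:
  assumes G: "pair_digraph G" "pverts G \<noteq> {}" and ord: "nw_order G k xs"
  shows "\<exists>lab. lnlc_graph (Suc k) G lab"
proof -
  have xs: "distinct xs" "set xs = pverts G"
    and le: "\<And>i. i \<le> length xs \<Longrightarrow> card (cut_nbhd G (set (drop i xs)) ` set (take i xs)) \<le> k"
    using ord unfolding nw_order_def by simp_all
  have loop: "(v, v) \<notin> parcs G" for v
    using G(1) pair_loopfree_digraph.pair_no_loops[of G "(v, v)"] by (auto simp: pair_digraph_def)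
  have ne: "xs \<noteq> []" using xs G(2) by auto
  have "\<exists>lab. lnlc_graph (Suc k) (induced G (set (take (Suc i) xs))) lab \<and>
      lab ` set (take (Suc i) xs) \<subseteq> {1..k} \<and>
      (\<forall>u \<in> set (take (Suc i) xs). \<forall>u' \<in> set (take (Suc i) xs). lab u = lab u' \<longrightarrow>
         cut_nbhd G (set (drop (Suc i) xs)) u = cut_nbhd G (set (drop (Suc i) xs)) u')"
    if "i < length xs" for i
    using that
  proof (induction i)
    case 0
    obtain v ys where v: "xs = v # ys" using ne by (cases xs) auto
    \<comment> \<open>The cut after the first vertex has exactly one class, so label 1 is
      available.\<close>
    have "1 \<le> k" using le[of 1] v by simp
    moreover have "lnlc_graph (Suc k) \<lparr>pverts = {v}, parcs = {}\<rparr> (\<lambda>_. 1)"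
      by (rule lnlc_graph.vertex) simp
    moreover have "induced G {v} = \<lparr>pverts = {v}, parcs = {}\<rparr>"
      using loop by (auto simp: induced_def)
    ultimately show ?case using v by (intro exI[of _ "\<lambda>_. 1"]) simp
  next
    case (Suc i)
    let ?A = "set (take (Suc i) xs)"
    define v where "v = xs ! Suc i"
    have take: "set (take (Suc (Suc i)) xs) = insert v ?A"
      and drop: "set (drop (Suc i) xs) = insert v (set (drop (Suc (Suc i)) xs))"
      using Suc.prems Cons_nth_drop_Suc[of "Suc i" xs, symmetric]
      by (simp_all add: v_def take_Suc_conv_app_nth insert_commute)
    have "v \<notin> ?A"
      using xs(1) Suc.prems by (auto simp: v_def in_set_conv_nth nth_eq_iff_index_eq)
    obtain lab where lab: "lnlc_graph (Suc k) (induced G ?A) lab" "lab ` ?A \<subseteq> {1..k}"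
      and same: "\<And>u u'. u \<in> ?A \<Longrightarrow> u' \<in> ?A \<Longrightarrow> lab u = lab u' \<Longrightarrow>
        cut_nbhd G (set (drop (Suc i) xs)) u = cut_nbhd G (set (drop (Suc i) xs)) u'"
      using Suc.IH[OF Suc_lessD[OF Suc.prems]] by meson
    have joined: "lnlc_graph (Suc k) (induced G (insert v ?A)) (lab(v := Suc k))"
    proof (rule lnlc_graph_join_induced)
      show "lnlc_graph (Suc k) (induced G ?A) lab" by fact
      show "v \<notin> ?A" by fact
      show "Suc k \<in> {1..Suc k}" by simp
      show "lab ` ?A \<subseteq> {1..Suc k}" using lab(2) by auto
      show "(v, v) \<notin> parcs G" by (rule loop)
      fix u u' assume "u \<in> ?A" "u' \<in> ?A" "lab u = lab u'"
      from same[OF this]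
      show "((u, v) \<in> parcs G \<longleftrightarrow> (u', v) \<in> parcs G) \<and> ((v, u) \<in> parcs G \<longleftrightarrow> (v, u') \<in> parcs G)"
        unfolding cut_nbhd_eq_iff drop by simp
    qed
    \<comment> \<open>Only \<open>v\<close> carries \<open>Suc k\<close>; for older vertices the
      right side merely shrinks, so equality of neighbourhoods persists.\<close>
    have same': "cut_nbhd G (set (drop (Suc (Suc i)) xs)) u
        = cut_nbhd G (set (drop (Suc (Suc i)) xs)) u'"
      if u: "u \<in> insert v ?A" "u' \<in> insert v ?A" "(lab(v := Suc k)) u = (lab(v := Suc k)) u'"
      for u u'
    proof (cases "u = v \<or> u' = v")
      case True
      have "lab w \<noteq> Suc k" if "w \<in> ?A" for w using lab(2) that by fastforce
      then have "u = u'" using True u by (auto split: if_splits)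
      then show ?thesis by simp
    next
      case False
      then have "u \<in> ?A" "u' \<in> ?A" "lab u = lab u'" using u by auto
      from same[OF this] show ?thesis unfolding cut_nbhd_eq_iff drop by simp
    qed
    have card: "card (cut_nbhd G (set (drop (Suc (Suc i)) xs)) ` insert v ?A) \<le> k"
      using le[of "Suc (Suc i)"] Suc.prems unfolding take by simp
    have "\<exists>lab'. lnlc_graph (Suc k) (induced G (insert v ?A)) lab' \<and>
      lab' ` insert v ?A \<subseteq> {1..k} \<and>
      (\<forall>u \<in> insert v ?A. \<forall>u' \<in> insert v ?A. lab' u = lab' u' \<longrightarrow>
         cut_nbhd G (set (drop (Suc (Suc i)) xs)) u = cut_nbhd G (set (drop (Suc (Suc i)) xs)) u')"
      using joined _ card _ _ same' by (rule lnlc_graph_relabel_classes) simp_all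
    then show ?case unfolding take .
  qed
  from this[of "length xs - 1"] show ?thesis
    using ne xs(2) induced_pverts[OF G(1)] by auto
qed

section \<open>Clique-width expressions simulating NLC-expressions\<close>

lemma lnlc_graph_labels: "lnlc_graph k H lab \<Longrightarrow> u \<in> pverts H \<Longrightarrow> lab u \<in> {1..k}"
  using lnlc_graph_label_order unfolding label_order_def by blast

text \<open>Labels are moved one at a time; as targets lie outside \<open>A\<close>, no vertex is
  moved twice.\<close>

lemma lcw_graph_relabel_set:
  assumes "finite A" "A \<subseteq> {1..n}" "R ` A \<subseteq> {1..n}" "R ` A \<inter> A = {}" "lcw_graph n H lab"
  shows "lcw_graph n H (\<lambda>u. if lab u \<in> A then R (lab u) else lab u)"
  using assms(1-4)
proof (induction A rule: finite_induct)
  case empty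
  then show ?case using assms(5) by simp
next
  case (insert a A)
  then have "lcw_graph n H (\<lambda>u. if lab u \<in> A then R (lab u) else lab u)" by auto
  from lcw_graph.relabel[OF this, of a "R a"] insert.prems
  have "lcw_graph n H (\<lambda>u. if (if lab u \<in> A then R (lab u) else lab u) = a then R a
      else (if lab u \<in> A then R (lab u) else lab u))" by auto
  also have "(\<lambda>u. if (if lab u \<in> A then R (lab u) else lab u) = a then R a
      else (if lab u \<in> A then R (lab u) else lab u))
    = (\<lambda>u. if lab u \<in> insert a A then R (lab u) else lab u)"
    using insert.prems(3) insert.hyps(2) by (auto simp: fun_eq_iff)
  finally show ?case .
qed

text \<open>
  The simultaneous relabelling \<open>R\<close> is performed by moving all labels out of the way, to a
  disjoint copy of the label set, before moving them to their destination.
\<close>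

lemma lcw_graph_relabel_fun:
  assumes "lcw_graph n H lab" "2 * k \<le> n" "R \<in> {1..k} \<rightarrow> {1..k}"
    and lab: "\<And>u. u \<in> pverts H \<Longrightarrow> lab u \<in> {1..k}"
  shows "\<exists>lab'. lcw_graph n H lab' \<and> (\<forall>u \<in> pverts H. lab' u = R (lab u))"
proof -
  let ?lab1 = "\<lambda>u. if lab u \<in> {1..k} then k + lab u else lab u"
  let ?lab2 = "\<lambda>u. if ?lab1 u \<in> {k + 1..k + k} then R (?lab1 u - k) else ?lab1 u"
  have "lcw_graph n H ?lab1"
    using assms(1,2) by (intro lcw_graph_relabel_set) auto
  then have "lcw_graph n H ?lab2"
  proof (rule lcw_graph_relabel_set[rotated 4])
    have "(\<lambda>l. R (l - k)) ` {k + 1..k + k} \<subseteq> {1..k}"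
    proof
      fix y assume "y \<in> (\<lambda>l. R (l - k)) ` {k + 1..k + k}"
      then obtain l where "y = R (l - k)" "l - k \<in> {1..k}" by force
      then show "y \<in> {1..k}" using assms(3) by (auto simp only: Pi_iff)
    qed
    then show "(\<lambda>l. R (l - k)) ` {k + 1..k + k} \<subseteq> {1..n}"
      "(\<lambda>l. R (l - k)) ` {k + 1..k + k} \<inter> {k + 1..k + k} = {}"
      using assms(2) by fastforce+
  qed (use assms(2) in auto)
  moreover have "?lab2 u = R (lab u)" if "u \<in> pverts H" for u using lab[OF that] by auto
  ultimately show ?thesis by blast
qed

text \<open>Adding arcs leaves the labels unchanged, so the pairs can be processed one by one;
  diagonal pairs are excluded because each operation joins two different labels.\<close>

lemma lcw_graph_add_arcs_set:
  assumes "finite P" "P \<subseteq> {1..n} \<times> {1..n}" "\<And>a. (a, a) \<notin> P" "lcw_graph n H lab"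
  shows "lcw_graph n
    \<lparr>pverts = pverts H,
     parcs = parcs H \<union> {(u, w). u \<in> pverts H \<and> w \<in> pverts H \<and> (lab u, lab w) \<in> P}\<rparr> lab"
  using assms(1-3)
proof (induction P rule: finite_induct)
  case empty
  then show ?case using assms(4) by (cases H) simp
next
  case (insert p P)
  obtain a b where p: "p = (a, b)" by force
  let ?H = "\<lparr>pverts = pverts H,
     parcs = parcs H \<union> {(u, w). u \<in> pverts H \<and> w \<in> pverts H \<and> (lab u, lab w) \<in> P}\<rparr>"
  have "lcw_graph n ?H lab" using insert by auto
  moreover have "a \<in> {1..n}" "b \<in> {1..n}" "a \<noteq> b" using insert.prems p by auto
  ultimately have "lcw_graph n
      \<lparr>pverts = pverts ?H,
       parcs = parcs ?H \<union> {(u, w). u \<in> pverts ?H \<and> w \<in> pverts ?H \<and> lab u = a \<and> lab w = b}\<rparr> lab"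
    by (rule lcw_graph.add_arcs)
  also have "\<lparr>pverts = pverts ?H,
       parcs = parcs ?H \<union> {(u, w). u \<in> pverts ?H \<and> w \<in> pverts ?H \<and> lab u = a \<and> lab w = b}\<rparr>
    = \<lparr>pverts = pverts H,
     parcs = parcs H \<union> {(u, w). u \<in> pverts H \<and> w \<in> pverts H \<and> (lab u, lab w) \<in> insert p P}\<rparr>"
    by (auto simp: p)
  finally show ?case .
qed

text \<open>\<open>2 * Suc k\<close> labels leave room for both needs: \<open>k + 1\<close> labels
  to keep a new vertex apart during a join, and \<open>2 * k\<close> labels for a simultaneous
  relabelling.\<close>

lemma lcw_graph_if_lnlc_graph:
  "lnlc_graph k H lab \<Longrightarrow>
     \<exists>lab'. lcw_graph (2 * Suc k) H lab' \<and> (\<forall>u \<in> pverts H. lab' u = lab u)"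
proof (induction rule: lnlc_graph.induct)
  case (vertex a v)
  then have "lcw_graph (2 * Suc k) \<lparr>pverts = {v}, parcs = {}\<rparr> (\<lambda>_. a)"
    by (intro lcw_graph.vertex) auto
  then show ?case by (intro exI[of _ "\<lambda>_. a"]) simp
next
  case (join H lab v a Sf Sb)
  let ?n = "2 * Suc k"
  let ?V = "insert v (pverts H)"
  obtain lab' where lab': "lcw_graph ?n H lab'" "\<And>u. u \<in> pverts H \<Longrightarrow> lab' u = lab u"
    using join.IH by blast
  have lab: "lab u \<in> {1..k}" if "u \<in> pverts H" for u
    using lnlc_graph_labels[OF join.hyps(1) that] .
  have wf: "parcs H \<subseteq> pverts H \<times> pverts H"
    using lnlc_graph_label_order[OF join.hyps(1)] unfolding label_order_def by blast
  define lab1 where "lab1 = lab'(v := Suc k)"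
  \<comment> \<open>While \<open>v\<close> alone carries \<open>Suc k\<close>, arcs between label
    classes with \<open>Suc k\<close> on one side are exactly arcs at \<open>v\<close>.\<close>
  define P where "P = {(l, Suc k) |l. (l, a) \<in> Sf} \<union> {(Suc k, l) |l. (l, a) \<in> Sb}"
  have lab1: "lab1 v = Suc k" "\<And>u. u \<in> pverts H \<Longrightarrow> lab1 u = lab u"
    using lab' join.hyps(2) by (auto simp: lab1_def)
  have Psub: "P \<subseteq> {1..?n} \<times> {1..?n}" "\<And>l. (l, l) \<notin> P"
    using join.hyps(4,5) by (fastforce simp: P_def)+
  then have "finite P" using finite_subset by blast
  have "lcw_graph ?n \<lparr>pverts = ?V, parcs = parcs H\<rparr> lab1"
    unfolding lab1_def using lab'(1) join.hyps(2) by (intro lcw_graph.add_vertex) auto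
  from lcw_graph_add_arcs_set[OF \<open>finite P\<close> Psub this]
  have "lcw_graph ?n
      \<lparr>pverts = ?V, parcs = parcs H \<union> {(u, w). u \<in> ?V \<and> w \<in> ?V \<and> (lab1 u, lab1 w) \<in> P}\<rparr> lab1"
    by simp
  also have "{(u, w). u \<in> ?V \<and> w \<in> ?V \<and> (lab1 u, lab1 w) \<in> P}
      = {(u, v) |u. u \<in> pverts H \<and> (lab u, a) \<in> Sf} \<union> {(v, u) |u. u \<in> pverts H \<and> (lab u, a) \<in> Sb}"
    (is "?L = ?R")
  proof -
    have neq: "lab u \<noteq> Suc k" if "u \<in> pverts H" for u using lab[OF that] by simp
    \<comment> \<open>This excludes a loop at \<open>v\<close>.\<close>
    have no: "(Suc k, a) \<notin> Sf" "(Suc k, a) \<notin> Sb" using join.hyps(4,5) by auto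
    have "(u, w) \<in> ?L \<longleftrightarrow> (u, w) \<in> ?R" for u w
      using lab1 neq no join.hyps(2) unfolding P_def by (cases "u = v"; cases "w = v") auto
    then show ?thesis by auto
  qed
  also have "parcs H \<union> \<dots> = parcs H \<union> {(u, v) |u. u \<in> pverts H \<and> (lab u, a) \<in> Sf}
      \<union> {(v, u) |u. u \<in> pverts H \<and> (lab u, a) \<in> Sb}" by blast
  finally have "lcw_graph ?n \<lparr>pverts = ?V, parcs = \<dots>\<rparr> (\<lambda>u. if lab1 u = Suc k then a else lab1 u)"
    using join.hyps(3) by (intro lcw_graph.relabel) auto
  moreover have "(if lab1 u = Suc k then a else lab1 u) = (lab(v := a)) u" if "u \<in> ?V" for u
    using that lab1 lab by fastforce
  ultimately show ?case by fastforce
next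
  case (relabel H lab R)
  then obtain lab' where lab': "lcw_graph (2 * Suc k) H lab'" "\<And>u. u \<in> pverts H \<Longrightarrow> lab' u = lab u"
    by blast
  have "lab' u \<in> {1..k}" if "u \<in> pverts H" for u
    using lnlc_graph_labels[OF relabel.hyps(1) that] lab'(2)[OF that] by simp
  from lcw_graph_relabel_fun[OF lab'(1) _ relabel.hyps(2) this]
  show ?case using lab'(2) by auto
qed

section \<open>Rank and number of distinct rows\<close>

definition gf4_row :: "'a set \<Rightarrow> ('a \<Rightarrow> 'a \<Rightarrow> gf4) \<Rightarrow> 'a \<Rightarrow> 'a \<Rightarrow> gf4" where
  "gf4_row B M x = (\<lambda>y. if y \<in> B then M x y else 0)"

lemma gf4_rank_eq_dim_rows: "gf4_rank A B M = gf4_fun.dim (gf4_row B M ` A)"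
  unfolding gf4_rank_def gf4_row_def ..

lemma gf4_row_eq_iff: "gf4_row B M x = gf4_row B M x' \<longleftrightarrow> (\<forall>y\<in>B. M x y = M x' y)"
  unfolding gf4_row_def fun_eq_iff by auto

lemma UNIV_gf4: "(UNIV :: gf4 set) = {GF_zero, GF_one, GF_omega, GF_omega2}"
  using gf4.exhaust by auto

lemma finite_UNIV_gf4: "finite (UNIV :: gf4 set)"
  by (simp add: UNIV_gf4)

lemma card_UNIV_gf4: "card (UNIV :: gf4 set) = 4"
  by (simp add: UNIV_gf4)

lemma gf4_rank_le_card_rows: "finite A \<Longrightarrow> gf4_rank A B M \<le> card (gf4_row B M ` A)"
  unfolding gf4_rank_eq_dim_rows by (intro gf4_fun.dim_le_card') simp

text \<open>Every row is a combination of a basis chosen among the rows, with 4 choices for each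
  coefficient.\<close>

lemma card_rows_le_power_rank:
  assumes "finite A"
  shows "card (gf4_row B M ` A) \<le> 4 ^ gf4_rank A B M"
proof -
  let ?S = "gf4_row B M ` A"
  obtain C where C: "C \<subseteq> ?S" "?S \<subseteq> gf4_fun.span C" "card C = gf4_fun.dim ?S"
    using gf4_fun.basis_exists[of ?S] by metis
  have "finite C" using C(1) assms finite_subset by blast
  let ?comb = "\<lambda>c. \<Sum>b\<in>C. gf4_scale (c b) b"
  have "?S \<subseteq> ?comb ` (C \<rightarrow>\<^sub>E UNIV)"
  proof
    fix r assume "r \<in> ?S"
    then obtain c where "r = ?comb c"
      using C(2) gf4_fun.span_finite[OF \<open>finite C\<close>] by blast
    \<comment> \<open>Restriction to the basis leaves only finitely many coefficient
      functions.\<close>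
    also have "\<dots> = ?comb (restrict c C)" by (intro sum.cong) simp_all
    finally show "r \<in> ?comb ` (C \<rightarrow>\<^sub>E UNIV)"
      by (intro image_eqI[where x = "restrict c C"]) simp_all
  qed
  moreover have fin: "finite (C \<rightarrow>\<^sub>E (UNIV :: gf4 set))"
    using \<open>finite C\<close> finite_UNIV_gf4 by (intro finite_PiE) simp_all
  ultimately have "card ?S \<le> card (C \<rightarrow>\<^sub>E (UNIV :: gf4 set))"
    by (meson card_image_le card_mono finite_imageI order_trans)
  also have "\<dots> = 4 ^ gf4_rank A B M"
    using \<open>finite C\<close> C(3) by (simp add: card_PiE card_UNIV_gf4 gf4_rank_eq_dim_rows)
  finally show ?thesis .
qed

text \<open>Columns in one class of \<open>N\<close> agree on \<open>A\<close>, so a row is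
  determined by its entries at one representative column per class.\<close>

lemma card_rows_le_power_columns:
  assumes "finite A" "finite (N ` B)"
    and "\<And>x y y'. x \<in> A \<Longrightarrow> y \<in> B \<Longrightarrow> y' \<in> B \<Longrightarrow> N y = N y' \<Longrightarrow> M x y = M x y'"
  shows "card (gf4_row B M ` A) \<le> 4 ^ card (N ` B)"
proof -
  define rep where "rep l = (SOME y. y \<in> B \<and> N y = l)" for l
  have rep: "rep (N y) \<in> B" "N (rep (N y)) = N y" if "y \<in> B" for y
    using someI[of "\<lambda>z. z \<in> B \<and> N z = N y" y] that unfolding rep_def by blast+
  have "card (gf4_row B M ` A) \<le> card (N ` B \<rightarrow>\<^sub>E (UNIV :: gf4 set))"
  proof (rule card_image_le_of_factor)
    show "finite A" by fact
    show "finite (N ` B \<rightarrow>\<^sub>E (UNIV :: gf4 set))"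
      using assms(2) finite_UNIV_gf4 by (intro finite_PiE) simp_all
    show "(\<lambda>x. restrict (\<lambda>l. M x (rep l)) (N ` B)) ` A \<subseteq> N ` B \<rightarrow>\<^sub>E UNIV" by auto
    fix x x' assume x: "x \<in> A" "x' \<in> A"
      and eq: "restrict (\<lambda>l. M x (rep l)) (N ` B) = restrict (\<lambda>l. M x' (rep l)) (N ` B)"
    have "M x y = M x' y" if y: "y \<in> B" for y
    proof -
      have "M x (rep (N y)) = M x' (rep (N y))" using fun_cong[OF eq, of "N y"] y by simp
      then show ?thesis using assms(3)[OF _ y rep(1)[OF y] rep(2)[OF y, symmetric]] x by simp
    qed
    then show "gf4_row B M x = gf4_row B M x'" by (simp add: gf4_row_eq_iff)
  qed
  then show ?thesis using assms(2) by (simp add: card_PiE card_UNIV_gf4)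
qed

section \<open>Arc matrices and cut neighbourhoods\<close>

lemma arc_matrix_eq_iff:
  "arc_matrix G x y = arc_matrix G x' y' \<longleftrightarrow>
     ((x, y) \<in> parcs G \<longleftrightarrow> (x', y') \<in> parcs G) \<and> ((y, x) \<in> parcs G \<longleftrightarrow> (y', x') \<in> parcs G)"
  by (simp add: arc_matrix_def zero_gf4_def one_gf4_def)

text \<open>The bridge between rank and neighbourhood-width: an entry encodes both arc directions
  faithfully, so distinct rows correspond to distinct classes.\<close>

lemma gf4_row_arc_matrix_eq_iff:
  "gf4_row Z (arc_matrix G) u = gf4_row Z (arc_matrix G) u' \<longleftrightarrow> cut_nbhd G Z u = cut_nbhd G Z u'"
  by (simp add: gf4_row_eq_iff arc_matrix_eq_iff cut_nbhd_eq_iff)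

lemma cut_nbhd_eq_mono:
  "cut_nbhd G Z u = cut_nbhd G Z u' \<Longrightarrow> Z' \<subseteq> Z \<Longrightarrow> cut_nbhd G Z' u = cut_nbhd G Z' u'"
  unfolding cut_nbhd_eq_iff by blast

lemma gf4_rank_cut_le:
  assumes "finite Y" "A \<subseteq> Y" "B \<subseteq> Z"
  shows "gf4_rank A B (arc_matrix G) \<le> card (cut_nbhd G Z ` Y)"
proof -
  have "finite A" using assms finite_subset by blast
  then have "gf4_rank A B (arc_matrix G) \<le> card (gf4_row B (arc_matrix G) ` A)"
    by (rule gf4_rank_le_card_rows)
  also have "\<dots> \<le> card (cut_nbhd G Z ` Y)"
    using \<open>finite A\<close> assms
    by (intro card_image_le_of_factor[where c = "cut_nbhd G Z"])
      (auto simp: gf4_row_arc_matrix_eq_iff intro: cut_nbhd_eq_mono)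
  finally show ?thesis .
qed

text \<open>The opposite orientation of the cut: the classes of \<open>Y\<close> now group columns
  instead of rows, which is the source of the exponential.\<close>

lemma gf4_rank_cut_converse_le:
  assumes "finite Y" "finite Z" "A \<subseteq> Z" "B \<subseteq> Y"
  shows "gf4_rank A B (arc_matrix G) \<le> 4 ^ card (cut_nbhd G Z ` Y)"
proof -
  have "finite A" "finite B" using assms finite_subset by blast+
  then have "gf4_rank A B (arc_matrix G) \<le> card (gf4_row B (arc_matrix G) ` A)"
    by (intro gf4_rank_le_card_rows)
  also have "\<dots> \<le> 4 ^ card (cut_nbhd G Z ` B)"
  proof (rule card_rows_le_power_columns)
    fix x y y' assume "x \<in> A" "cut_nbhd G Z y = cut_nbhd G Z y'"
    then show "arc_matrix G x y = arc_matrix G x y'"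
      using assms(3) unfolding cut_nbhd_eq_iff arc_matrix_eq_iff by auto
  qed (use \<open>finite A\<close> \<open>finite B\<close> in simp_all)
  also have "\<dots> \<le> 4 ^ card (cut_nbhd G Z ` Y)"
    using assms by (intro power_increasing card_mono) auto
  finally show ?thesis .
qed

lemma card_cut_nbhd_le_power_rank:
  assumes "finite A" "Y \<subseteq> A" "Z \<subseteq> B"
  shows "card (cut_nbhd G Z ` Y) \<le> 4 ^ gf4_rank A B (arc_matrix G)"
proof -
  have "card (cut_nbhd G Z ` Y) \<le> card (gf4_row B (arc_matrix G) ` A)"
    using assms finite_subset[OF assms(2,1)]
    by (intro card_image_le_of_factor[where c = "gf4_row B (arc_matrix G)"])
      (auto simp: gf4_row_arc_matrix_eq_iff intro: cut_nbhd_eq_mono)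
  also have "\<dots> \<le> 4 ^ gf4_rank A B (arc_matrix G)" using assms(1) by (rule card_rows_le_power_rank)
  finally show ?thesis .
qed

section \<open>A caterpillar from a linear order\<close>

text \<open>A set containing \<open>s\<close> and closed under the remaining arcs contains the
  component of \<open>s\<close>.\<close>

lemma edge_side_subset:
  assumes "s \<in> S"
    and "\<And>x y. (x, y) \<in> parcs T \<Longrightarrow> x \<in> S \<Longrightarrow> (x, y) \<noteq> (s, t) \<Longrightarrow> (x, y) \<noteq> (t, s) \<Longrightarrow> y \<in> S"
  shows "edge_side G T f s t \<subseteq> {v \<in> pverts G. f v \<in> S}"
proof -
  have "x \<in> S" if "(s, x) \<in> rtrancl_on (pverts T) (parcs T - {(s, t), (t, s)})" for x
    using that by (induction rule: rtrancl_on_induct) (use assms in auto)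
  then show ?thesis unfolding edge_side_def reachable_def del_edge_def by auto
qed

definition comb_arcs :: "nat \<Rightarrow> (nat \<times> nat) set" where
  "comb_arcs n = {(i, Suc i) |i. Suc i < n} \<union> {(n + i, i) |i. i < n}"

definition comb :: "nat \<Rightarrow> nat pair_pre_digraph" where
  "comb n = \<lparr>pverts = {..<2 * n}, parcs = comb_arcs n \<union> (comb_arcs n)\<inverse>\<rparr>"

lemma pair_graph_comb: "pair_graph (comb n)"
proof -
  have "comb_arcs n \<subseteq> {..<2 * n} \<times> {..<2 * n}" unfolding comb_arcs_def by auto
  moreover from this have "finite (comb_arcs n)" by (rule finite_subset) simp
  moreover have "(i, i) \<notin> comb_arcs n" for i unfolding comb_arcs_def by auto
  ultimately show ?thesis
    by unfold_locales (auto simp: comb_def symmetric_def sym_def)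
qed

lemma caterpillar_comb:
  assumes "0 < n"
  shows "caterpillar (comb n)"
proof -
  have "pverts (comb n) - set [0..<n] = {n..<2 * n}" by (auto simp: comb_def)
  moreover have "{(x, x - n) |x. x \<in> {n..<2 * n}} = {(n + i, i) |i. i < n}"
    by (auto intro: exI[of _ "n + _"])
  moreover have "{([0..<n] ! i, [0..<n] ! Suc i) |i. Suc i < length [0..<n]}
      = {(i, Suc i) |i. Suc i < n}"
  proof -
    have "[0..<n] ! i = i" "[0..<n] ! Suc i = Suc i" if "Suc i < n" for i using that by simp_all
    then show ?thesis by (metis (no_types, lifting) length_upt diff_zero)
  qed
  ultimately show ?thesis
    using assms pair_graph_comb unfolding caterpillar_def Let_def
    by (intro conjI exI[of _ "[0..<n]"] exI[of _ "\<lambda>x. x - n"])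
      (auto simp: comb_def comb_arcs_def)
qed

text \<open>At the two ends of the path the right-hand side lists pairs that are not arcs, such as
  \<open>(0, 0)\<close> from the truncated \<open>i - 1\<close>; only an upper bound is
  claimed.\<close>

lemma out_arcs_comb_path:
  "i < n \<Longrightarrow> out_arcs (with_proj (comb n)) i \<subseteq> {(i, n + i), (i, Suc i), (i, i - 1)}"
  unfolding out_arcs_def by (auto simp: comb_def comb_arcs_def)

lemma out_arcs_comb_pendant: "i < n \<Longrightarrow> out_arcs (with_proj (comb n)) (n + i) = {(n + i, i)}"
  unfolding out_arcs_def by (auto simp: comb_def comb_arcs_def)

lemma comb_vertex_cases:
  assumes "x \<in> pverts (comb n)"
  obtains i where "i < n" "x = i" | i where "i < n" "x = n + i"
proof (cases "x < n")
  case False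
  then have "x - n < n" "x = n + (x - n)" using assms by (auto simp: comb_def)
  then show ?thesis using that(2) by blast
qed (use that(1) in blast)

lemma subcubic_comb: "subcubic (comb n)"
  unfolding subcubic_def
proof
  fix x assume "x \<in> pverts (comb n)"
  then show "out_degree (with_proj (comb n)) x \<le> 3"
  proof (cases rule: comb_vertex_cases)
    case (1 i)
    have "card (out_arcs (with_proj (comb n)) i) \<le> card {(i, n + i), (i, Suc i), (i, i - 1)}"
      using out_arcs_comb_path[OF 1(1)] by (rule card_mono[rotated]) simp
    also have "\<dots> \<le> 3" by (rule card_insert_le_m1 | simp)+
    finally show ?thesis by (simp add: out_degree_def 1)
  next
    case (2 i)
    then show ?thesis by (simp add: out_degree_def out_arcs_comb_pendant)
  qed
qed

text \<open>With at least two path nodes, each has a path neighbour besides its pendant. For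
  \<open>n = 1\<close> the comb is a single edge and both of its ends are leaves.\<close>

lemma leaves_comb:
  assumes "2 \<le> n"
  shows "leaves (comb n) = (+) n ` {..<n}"
proof -
  have "\<not> out_degree (with_proj (comb n)) i \<le> 1" if "i < n" for i
  proof -
    \<comment> \<open>A neighbour on the path: the successor, or the predecessor at the last
      node.\<close>
    define j where "j = (if Suc i < n then Suc i else i - 1)"
    have "(i, n + i) \<in> parcs (comb n)" "(i, j) \<in> parcs (comb n)"
      using that assms unfolding comb_def comb_arcs_def j_def by auto
    then have "{(i, n + i), (i, j)} \<subseteq> out_arcs (with_proj (comb n)) i" by auto
    moreover have "finite (out_arcs (with_proj (comb n)) i)"
      using finite_subset[OF out_arcs_comb_path[OF that]] by simp
    ultimately have "card {(i, n + i), (i, j)} \<le> out_degree (with_proj (comb n)) i"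
      unfolding out_degree_def by (intro card_mono)
    moreover have "j \<noteq> n + i" using that by (auto simp: j_def)
    ultimately show ?thesis by simp
  qed
  moreover have "out_degree (with_proj (comb n)) (n + i) = 1" if "i < n" for i
    using that by (simp add: out_degree_def out_arcs_comb_pendant)
  moreover have "n + i \<in> pverts (comb n)" if "i < n" for i using that by (simp add: comb_def)
  ultimately show ?thesis
    unfolding leaves_def by (auto elim!: comb_vertex_cases)
qed

lemma gf4_rank_comb_edge_le:
  assumes ord: "nw_order G k xs" and k: "1 \<le> k"
    and f: "\<And>i. i < length xs \<Longrightarrow> f (xs ! i) = length xs + i"
    and st: "(s, t) \<in> parcs (comb (length xs))"
  shows "gf4_rank (edge_side G (comb (length xs)) f s t) (edge_side G (comb (length xs)) f t s)
    (arc_matrix G) \<le> 4 ^ k"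
proof -
  let ?n = "length xs" and ?T = "comb (length xs)"
  have xs: "distinct xs" "set xs = pverts G"
    and le: "\<And>i. i \<le> length xs \<Longrightarrow> card (cut_nbhd G (set (drop i xs)) ` set (take i xs)) \<le> k"
    using ord unfolding nw_order_def by simp_all
  \<comment> \<open>Position along the path, shared by a path node and its pendant. It changes only
    along path edges and only by one, so just the edge between \<open>i\<close> and
    \<open>Suc i\<close> crosses from \<open>pos x \<le> i\<close> to larger positions.\<close>
  define pos where "pos x = (if x < ?n then x else x - ?n)" for x
  have arcs: "(x, y) \<in> parcs ?T \<Longrightarrow> pos x = pos y \<or> Suc (pos x) = pos y \<and> x = pos x \<and> y = pos y
      \<or> pos x = Suc (pos y) \<and> x = pos x \<and> y = pos y" for x y
    by (auto simp: comb_def comb_arcs_def pos_def)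
  have fin: "finite (pverts G)" using xs by (metis List.finite_set)
  have sub: "edge_side G ?T f s t \<subseteq> pverts G" for s t by (auto simp: edge_side_def)
  have vert: "\<exists>j<?n. v = xs ! j \<and> f v = ?n + j" if "v \<in> pverts G" for v
    using that xs(2) f by (metis in_set_conv_nth)
  have low: "edge_side G ?T f i (Suc i) \<subseteq> set (take (Suc i) xs)" if "Suc i < ?n" for i
  proof -
    have "edge_side G ?T f i (Suc i) \<subseteq> {v \<in> pverts G. f v \<in> {x. pos x \<le> i}}"
    proof (rule edge_side_subset)
      show "i \<in> {x. pos x \<le> i}" using that by (simp add: pos_def)
      fix x y assume "(x, y) \<in> parcs ?T" "x \<in> {x. pos x \<le> i}" "(x, y) \<noteq> (i, Suc i)"
      then show "y \<in> {x. pos x \<le> i}" using arcs[of x y] by (auto simp: le_Suc_eq)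
    qed
    also have "\<dots> \<subseteq> set (take (Suc i) xs)"
    proof
      fix v assume "v \<in> {v \<in> pverts G. f v \<in> {x. pos x \<le> i}}"
      then obtain j where "v = xs ! j" "j < Suc i"
        by (auto dest!: vert simp: pos_def)
      then have "v = take (Suc i) xs ! j" "j < length (take (Suc i) xs)" using that by auto
      then show "v \<in> set (take (Suc i) xs)" by (metis nth_mem)
    qed
    finally show ?thesis .
  qed
  have high: "edge_side G ?T f (Suc i) i \<subseteq> set (drop (Suc i) xs)" if "Suc i < ?n" for i
  proof -
    have "edge_side G ?T f (Suc i) i \<subseteq> {v \<in> pverts G. f v \<in> {x. Suc i \<le> pos x}}"
    proof (rule edge_side_subset)
      show "Suc i \<in> {x. Suc i \<le> pos x}" using that by (simp add: pos_def)
      fix x y assume "(x, y) \<in> parcs ?T" "x \<in> {x. Suc i \<le> pos x}" "(x, y) \<noteq> (Suc i, i)"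
      then show "y \<in> {x. Suc i \<le> pos x}" using arcs[of x y] by (auto simp: le_Suc_eq)
    qed
    also have "\<dots> \<subseteq> set (drop (Suc i) xs)"
    proof
      fix v assume "v \<in> {v \<in> pverts G. f v \<in> {x. Suc i \<le> pos x}}"
      then obtain j where "j < ?n" "v = xs ! j" "Suc i \<le> j"
        by (auto dest!: vert simp: pos_def)
      then have "v = drop (Suc i) xs ! (j - Suc i)" "j - Suc i < length (drop (Suc i) xs)" by auto
      then show "v \<in> set (drop (Suc i) xs)" by (metis nth_mem)
    qed
    finally show ?thesis .
  qed
  have pendant: "edge_side G ?T f (?n + i) i \<subseteq> {xs ! i}" if "i < ?n" for i
  proof -
    have "edge_side G ?T f (?n + i) i \<subseteq> {v \<in> pverts G. f v \<in> {?n + i}}"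
      by (rule edge_side_subset) (use that in \<open>auto simp: comb_def comb_arcs_def\<close>)
    then show ?thesis using vert by fastforce
  qed
  \<comment> \<open>The second bound is for a pendant edge with the leaf on the column side: one
    class gives \<open>4 ^ 1\<close>, hence the assumption on \<open>k\<close>.\<close>
  have k4: "k \<le> 4 ^ k" "4 ^ 1 \<le> (4 :: nat) ^ k"
    using k less_exp[of k] power_mono[of 2 "4 :: nat" k] power_increasing[of 1 k "4 :: nat"]
    by linarith+
  consider i where "Suc i < ?n" "s = i" "t = Suc i" | i where "Suc i < ?n" "s = Suc i" "t = i"
    | i where "i < ?n" "s = ?n + i" "t = i" | i where "i < ?n" "s = i" "t = ?n + i"
    using st by (auto simp: comb_def comb_arcs_def)
  then show ?thesis
  proof cases
    case (1 i)
    have "gf4_rank (edge_side G ?T f i (Suc i)) (edge_side G ?T f (Suc i) i) (arc_matrix G)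
        \<le> card (cut_nbhd G (set (drop (Suc i) xs)) ` set (take (Suc i) xs))"
      using low high 1(1) by (intro gf4_rank_cut_le) simp_all
    then show ?thesis using le[of "Suc i"] 1(1) k4(1) unfolding 1(2,3) by linarith
  next
    case (2 i)
    have "gf4_rank (edge_side G ?T f (Suc i) i) (edge_side G ?T f i (Suc i)) (arc_matrix G)
        \<le> 4 ^ card (cut_nbhd G (set (drop (Suc i) xs)) ` set (take (Suc i) xs))"
      using low high 2(1) by (intro gf4_rank_cut_converse_le) simp_all
    also have "\<dots> \<le> 4 ^ k" using le[of "Suc i"] 2(1) by (intro power_increasing) simp_all
    finally show ?thesis using 2 by simp
  next
    case (3 i)
    have "gf4_rank (edge_side G ?T f (?n + i) i) (edge_side G ?T f i (?n + i)) (arc_matrix G)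
        \<le> card (cut_nbhd G (pverts G) ` {xs ! i})"
      using pendant sub 3(1) by (intro gf4_rank_cut_le) simp_all
    also have "\<dots> \<le> 4 ^ k" by simp
    finally show ?thesis unfolding 3(2,3) .
  next
    case (4 i)
    have "gf4_rank (edge_side G ?T f i (?n + i)) (edge_side G ?T f (?n + i) i) (arc_matrix G)
        \<le> 4 ^ card (cut_nbhd G (pverts G) ` {xs ! i})"
      using pendant sub fin 4(1) by (intro gf4_rank_cut_converse_le) simp_all
    then show ?thesis using 4 k4(2) by simp
  qed
qed

lemma decomposition_if_nw_order:
  assumes G: "pverts G \<noteq> {}" and ord: "nw_order G k xs"
  shows "\<exists>(T :: nat pair_pre_digraph) f. caterpillar T \<and> subcubic T \<and>
    bij_betw f (pverts G) (leaves T) \<and> decomp_width G T f \<le> 4 ^ k"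
proof -
  have xs: "distinct xs" "set xs = pverts G"
    and le: "\<And>i. i \<le> length xs \<Longrightarrow> card (cut_nbhd G (set (drop i xs)) ` set (take i xs)) \<le> k"
    using ord unfolding nw_order_def by simp_all
  show ?thesis
  proof (cases "2 \<le> length xs")
    case True
    let ?n = "length xs"
    have "1 \<le> k" using le[of 1] True by (cases xs) simp_all
    have bij: "bij_betw ((!) xs) {..<?n} (pverts G)" using xs bij_betw_nth by blast
    define f where "f v = ?n + inv_into {..<?n} ((!) xs) v" for v
    have f: "f (xs ! i) = ?n + i" if "i < ?n" for i
      using bij_betw_inv_into_left[OF bij, of i] that by (simp add: f_def)
    have "bij_betw f (pverts G) (leaves (comb ?n))"
      unfolding leaves_comb[OF True] f_def
      using bij_betw_trans[OF bij_betw_inv_into[OF bij], of "(+) ?n" "(+) ?n ` {..<?n}"]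
      by (simp add: comp_def bij_betw_def)
    moreover have "decomp_width G (comb ?n) f \<le> 4 ^ k"
      unfolding decomp_width_def
    proof (subst SUP_nat_le_iff)
      show "finite (parcs (comb ?n))"
        using pair_graph_comb by (meson pair_digraph_def pair_fin_digraph.pair_finite_arcs
            pair_graph.axioms(1))
      show "\<forall>e\<in>parcs (comb ?n). (case e of (s, t) \<Rightarrow> gf4_rank (edge_side G (comb ?n) f s t)
          (edge_side G (comb ?n) f t s) (arc_matrix G)) \<le> 4 ^ k"
        using gf4_rank_comb_edge_le[OF ord \<open>1 \<le> k\<close> f] by auto
    qed
    moreover have "caterpillar (comb ?n)" by (rule caterpillar_comb) (use True in linarith)
    ultimately show ?thesis using subcubic_comb by blast
  next
    case False
    moreover have "length xs \<noteq> 0" using xs(2) G by auto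
    ultimately have "length xs = 1" by linarith
    then obtain v where v: "pverts G = {v}" using xs(2) by (fastforce simp: length_Suc_conv)
    \<comment> \<open>For one vertex the comb would have two leaves; the one-node tree is used
      instead, and its width is an empty supremum.\<close>
    let ?T = "\<lparr>pverts = {0}, parcs = {}\<rparr> :: nat pair_pre_digraph"
    have "pair_graph ?T" by unfold_locales (auto simp: symmetric_def sym_def)
    then have "caterpillar ?T"
      unfolding caterpillar_def Let_def by (intro conjI exI[of _ "[0]"]) auto
    moreover have "out_arcs (with_proj ?T) x = {}" for x unfolding out_arcs_def by simp
    then have "subcubic ?T" "leaves ?T = {0}"
      unfolding subcubic_def leaves_def out_degree_def by auto
    moreover have "decomp_width G ?T f \<le> 4 ^ k" for f by (simp add: decomp_width_def)
    moreover have "bij_betw (\<lambda>_. 0) (pverts G) {0 :: nat}" by (simp add: v bij_betw_def)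
    ultimately show ?thesis by metis
  qed
qed

section \<open>A linear order from a caterpillar\<close>

text \<open>Sides of path edges will be bounded from below, so the locale records the presence of
  arcs that walk along the path in both directions and out to the pendants.\<close>

locale caterpillar_path =
  fixes T :: "'b pair_pre_digraph" and p :: "'b list" and g :: "'b \<Rightarrow> 'b"
  assumes path: "distinct p" "set p \<subseteq> pverts T"
    and pendant: "\<And>x. x \<in> pverts T \<Longrightarrow> x \<notin> set p \<Longrightarrow> g x \<in> set p"
    and path_arcs: "\<And>i. Suc i < length p \<Longrightarrow>
      (p ! i, p ! Suc i) \<in> parcs T \<and> (p ! Suc i, p ! i) \<in> parcs T"
    and pendant_arcs: "\<And>x. x \<in> pverts T \<Longrightarrow> x \<notin> set p \<Longrightarrow> (g x, x) \<in> parcs T"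
    and finite_arcs: "finite (parcs T)"
begin

definition base :: "'b \<Rightarrow> nat" where
  "base x = (SOME i. i < length p \<and> p ! i = (if x \<in> set p then x else g x))"

lemma base:
  assumes "x \<in> pverts T"
  shows "base x < length p" "p ! base x = (if x \<in> set p then x else g x)"
proof -
  have "\<exists>i. i < length p \<and> p ! i = (if x \<in> set p then x else g x)"
    using pendant[OF assms] by (metis in_set_conv_nth)
  then have "base x < length p \<and> p ! base x = (if x \<in> set p then x else g x)"
    unfolding base_def by (rule someI_ex)
  then show "base x < length p" "p ! base x = (if x \<in> set p then x else g x)" by blast+
qed

text \<open>A fibre consists of nodes among the path node and its at most 3 neighbours, hence
  \<open>1 + 3\<close>.\<close>

lemma finite_base_fibre: "finite {x \<in> pverts T. base x = j}"
  and card_base_fibre_le: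
    "subcubic T \<Longrightarrow> j < length p \<Longrightarrow> card {x \<in> pverts T. base x = j} \<le> 4"
proof -
  let ?out = "snd ` out_arcs (with_proj T) (p ! j)"
  have fin: "finite (out_arcs (with_proj T) (p ! j))"
    unfolding out_arcs_def using finite_arcs by simp
  have sub: "{x \<in> pverts T. base x = j} \<subseteq> insert (p ! j) ?out"
  proof
    fix x assume "x \<in> {x \<in> pverts T. base x = j}"
    then have x: "x \<in> pverts T" "p ! j = (if x \<in> set p then x else g x)" using base(2) by auto
    show "x \<in> insert (p ! j) ?out"
    proof (cases "x \<in> set p")
      case False
      then have "(p ! j, x) \<in> out_arcs (with_proj T) (p ! j)"
        using pendant_arcs[OF x(1)] x(2) by simp
      then show ?thesis by force
    qed (use x in simp)
  qed
  then show "finite {x \<in> pverts T. base x = j}" using fin finite_subset by blast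
  assume "subcubic T" "j < length p"
  then have "card (out_arcs (with_proj T) (p ! j)) \<le> 3"
    using path(2) nth_mem unfolding subcubic_def out_degree_def by blast
  then have "card ?out \<le> 3" using card_image_le[OF fin] order_trans by blast
  have "card {x \<in> pverts T. base x = j} \<le> card (insert (p ! j) ?out)"
    using sub fin by (intro card_mono) simp_all
  also have "\<dots> \<le> Suc (card ?out)" by (rule card_insert_le_m1) simp_all
  finally show "card {x \<in> pverts T. base x = j} \<le> 4" using \<open>card ?out \<le> 3\<close> by linarith
qed

context
  fixes j assumes j: "Suc j < length p"
begin

abbreviation (input) cut_arcs :: "'b rel" where
  "cut_arcs \<equiv> parcs T - {(p ! j, p ! Suc j), (p ! Suc j, p ! j)}"

lemma path_cut_arcs:
  assumes "Suc i < length p" "i \<noteq> j"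
  shows "(p ! i, p ! Suc i) \<in> cut_arcs" "(p ! Suc i, p ! i) \<in> cut_arcs"
  using path_arcs[OF assms(1)] assms j path(1) by (auto simp: nth_eq_iff_index_eq)

lemma pendant_cut_arcs:
  assumes "x \<in> pverts T" "x \<notin> set p"
  shows "(g x, x) \<in> cut_arcs"
  using pendant_arcs[OF assms] assms(2) j nth_mem[of j p] nth_mem[of "Suc j" p] by auto

text \<open>Induction on the distance \<open>d\<close> from the cut: the walk leads away from the
  removed edge and never uses it.\<close>

lemma reach_below: "d \<le> j \<Longrightarrow> (p ! j, p ! (j - d)) \<in> rtrancl_on (pverts T) cut_arcs"
proof (induction d)
  case 0
  then show ?case using j path(2) by (simp add: subset_iff)
next
  case (Suc d)
  define i where "i = j - Suc d"
  have i: "j - d = Suc i" "Suc i < length p" "i \<noteq> j" using Suc.prems j by (auto simp: i_def)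
  have "p ! i \<in> pverts T" using i(2) path(2) by (simp add: subset_iff)
  then show ?case
    using Suc i path_cut_arcs(2)[OF i(2,3)] unfolding i_def[symmetric]
    by (auto intro: rtrancl_on_into_rtrancl_on)
qed

lemma reach_above:
  "Suc j + d < length p \<Longrightarrow> (p ! Suc j, p ! (Suc j + d)) \<in> rtrancl_on (pverts T) cut_arcs"
proof (induction d)
  case 0
  then show ?case using path(2) by (simp add: subset_iff)
next
  case (Suc d)
  define i where "i = Suc j + d"
  have i: "Suc j + Suc d = Suc i" "Suc i < length p" "i \<noteq> j" using Suc.prems by (auto simp: i_def)
  have "p ! Suc i \<in> pverts T" using i(2) path(2) by (simp add: subset_iff)
  moreover have "(p ! Suc j, p ! i) \<in> rtrancl_on (pverts T) cut_arcs"
    using Suc.IH i unfolding i_def[symmetric] by simp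
  ultimately show ?case
    using path_cut_arcs(1)[OF i(2,3)] unfolding i(1) by (auto intro: rtrancl_on_into_rtrancl_on)
qed

text \<open>The last step to a pendant survives the cut, because both ends of the removed edge lie
  on the path.\<close>

lemma reach_from_base:
  assumes "(s, p ! base x) \<in> rtrancl_on (pverts T) cut_arcs" "x \<in> pverts T"
  shows "(s, x) \<in> rtrancl_on (pverts T) cut_arcs"
proof (cases "x \<in> set p")
  case True
  then show ?thesis using assms base(2) by simp
next
  case False
  then show ?thesis
    using assms base(2) pendant_cut_arcs by (auto intro: rtrancl_on_into_rtrancl_on)
qed

lemma edge_side_below:
  assumes "f ` pverts G \<subseteq> pverts T"
  shows "{v \<in> pverts G. base (f v) \<le> j} \<subseteq> edge_side G T f (p ! j) (p ! Suc j)"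
proof -
  have "(p ! j, x) \<in> rtrancl_on (pverts T) cut_arcs" if "x \<in> pverts T" "base x \<le> j" for x
    using reach_below[of "j - base x"] that by - (rule reach_from_base, simp_all)
  then show ?thesis
    using assms unfolding edge_side_def reachable_def del_edge_def by auto
qed

lemma edge_side_above:
  assumes "f ` pverts G \<subseteq> pverts T"
  shows "{v \<in> pverts G. j < base (f v)} \<subseteq> edge_side G T f (p ! Suc j) (p ! j)"
proof -
  have "(p ! Suc j, x) \<in> rtrancl_on (pverts T) cut_arcs" if "x \<in> pverts T" "j < base x" for x
    using reach_above[of "base x - Suc j"] that base(1) by - (rule reach_from_base, simp_all)
  then show ?thesis
    using assms unfolding edge_side_def reachable_def del_edge_def
    by (auto simp: insert_commute)
qed

end

end

lemma caterpillar_path_exists: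
  assumes "caterpillar T"
  shows "\<exists>p g. caterpillar_path T p g"
proof -
  obtain p g where p: "distinct p" "set p \<subseteq> pverts T" "g \<in> pverts T - set p \<rightarrow> set p"
    and arcs: "parcs T =
      ({(p ! i, p ! Suc i) |i. Suc i < length p} \<union> {(x, g x) |x. x \<in> pverts T - set p}) \<union>
      ({(p ! i, p ! Suc i) |i. Suc i < length p} \<union> {(x, g x) |x. x \<in> pverts T - set p})\<inverse>"
    using assms unfolding caterpillar_def Let_def by (elim conjE exE) (rule that)
  have "finite (parcs T)"
    using assms unfolding caterpillar_def
    by (meson pair_digraph_def pair_fin_digraph.pair_finite_arcs pair_graph.axioms(1))
  then have "caterpillar_path T p g"
    using p by unfold_locales (auto simp: arcs)
  then show ?thesis by blast
qed

lemma nw_order_if_decomposition: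
  assumes fin: "finite (pverts G)" and T: "caterpillar T" "subcubic T"
    and f: "bij_betw f (pverts G) (leaves T)" and width: "decomp_width G T f \<le> k"
  shows "\<exists>xs. nw_order G (4 ^ k + 4) xs"
proof -
  obtain p g where "caterpillar_path T p g" using caterpillar_path_exists[OF T(1)] by blast
  then interpret caterpillar_path T p g .
  have fT: "f ` pverts G \<subseteq> pverts T" and inj: "inj_on f (pverts G)"
    using f by (auto simp: bij_betw_def leaves_def)
  have edge: "gf4_rank (edge_side G T f s t) (edge_side G T f t s) (arc_matrix G) \<le> k"
    if "(s, t) \<in> parcs T" for s t
    using width that unfolding decomp_width_def SUP_nat_le_iff[OF finite_arcs] by auto
  define key where "key v = base (f v)" for v
  obtain ys where ys: "set ys = pverts G" "distinct ys" using fin finite_distinct_list by blast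
  define xs where "xs = sort_key key ys"
  have xs: "set xs = pverts G" "distinct xs" "sorted (map key xs)"
    using ys by (simp_all add: xs_def)
  have "card (cut_nbhd G (set (drop i xs)) ` set (take i xs)) \<le> 4 ^ k + 4"
    if i: "i \<le> length xs" for i
  proof (cases i)
    case (Suc m)
    let ?Y = "set (take i xs)" and ?Z = "set (drop i xs)"
    \<comment> \<open>The path position of the last vertex on the left. Vertices strictly before it
      are separated from the whole right side by the path edge entering \<open>p ! j\<close>; those
      at \<open>j\<close> number at most 4 and give at most one class each.\<close>
    define j where "j = key (xs ! m)"
    have mono: "key (xs ! a) \<le> key (xs ! b)" if "a \<le> b" "b < length xs" for a b
      using sorted_nth_mono[OF xs(3), of a b] that by simp
    have Y: "key y \<le> j" "y \<in> pverts G" if "y \<in> ?Y" for y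
      using that mono i Suc xs(1) in_set_takeD[OF that] by (auto simp: in_set_conv_nth j_def)
    have Z: "j \<le> key z" "z \<in> pverts G" if "z \<in> ?Z" for z
      using that mono i Suc xs(1) in_set_dropD[OF that] by (auto simp: in_set_conv_nth j_def)
    have "xs ! m \<in> pverts G" using xs(1) i Suc nth_mem[of m xs] by simp
    then have "j < length p" using base(1) fT unfolding j_def key_def by auto
    define Y1 where "Y1 = {y \<in> ?Y. key y < j}"
    define Y2 where "Y2 = {y \<in> ?Y. key y = j}"
    have "?Y = Y1 \<union> Y2" using Y(1) unfolding Y1_def Y2_def by (auto simp: le_less)
    have "card Y2 \<le> 4"
    proof -
      have "f ` Y2 \<subseteq> {x \<in> pverts T. base x = j}"
        using Y(2) fT unfolding Y2_def key_def by auto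
      then have "card (f ` Y2) \<le> card {x \<in> pverts T. base x = j}"
        using finite_base_fibre by (intro card_mono)
      moreover have "inj_on f Y2" using inj Y(2) unfolding Y2_def by (auto intro: inj_on_subset)
      ultimately show ?thesis
        using card_base_fibre_le[OF T(2) \<open>j < length p\<close>] by (simp add: card_image)
    qed
    moreover have "finite Y2" by (simp add: Y2_def)
    ultimately have "card (cut_nbhd G ?Z ` Y2) \<le> 4"
      using card_image_le order_trans by blast
    moreover have "card (cut_nbhd G ?Z ` Y1) \<le> 4 ^ k"
    \<comment> \<open>At the first path node there is no entering edge, but then nothing lies
      strictly before it.\<close>
    proof (cases j)
      case 0
      then show ?thesis by (simp add: Y1_def)
    next
      case (Suc l)
      then have l: "Suc l < length p" using \<open>j < length p\<close> by simp
      let ?A = "edge_side G T f (p ! l) (p ! Suc l)"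
      let ?B = "edge_side G T f (p ! Suc l) (p ! l)"
      have "Y1 \<subseteq> ?A"
        using edge_side_below[OF l fT] Y(2) Suc unfolding Y1_def key_def by fastforce
      moreover have "?Z \<subseteq> ?B"
        using edge_side_above[OF l fT] Z Suc unfolding key_def by fastforce
      moreover have "finite ?A" using fin unfolding edge_side_def by simp
      ultimately have "card (cut_nbhd G ?Z ` Y1) \<le> 4 ^ gf4_rank ?A ?B (arc_matrix G)"
        by (intro card_cut_nbhd_le_power_rank)
      also have "\<dots> \<le> 4 ^ k" using edge path_arcs[OF l] by (intro power_increasing) simp_all
      finally show ?thesis .
    qed
    moreover have "card (cut_nbhd G ?Z ` ?Y) \<le> card (cut_nbhd G ?Z ` Y1) + card (cut_nbhd G ?Z ` Y2)"
      unfolding \<open>?Y = Y1 \<union> Y2\<close> image_Un by (rule card_Un_le)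
    ultimately show ?thesis by linarith
  qed simp
  then show ?thesis unfolding nw_order_def using xs(1,2) by blast
qed

section \<open>Comparison of the parameters\<close>

lemma finite_pverts: "pair_digraph G \<Longrightarrow> finite (pverts G)"
  by (meson pair_digraph_def pair_fin_digraph.pair_finite_verts)

lemma nw_order_d_nw: "pair_digraph G \<Longrightarrow> \<exists>xs. nw_order G (d_nw G) xs"
  using d_nw_le_iff_nw_order[OF finite_pverts] by blast

text \<open>The other three parameters are 0 here by convention; for \<open>d_nw\<close> the empty
  list is the witness.\<close>

lemma d_nw_empty:
  assumes "pverts G = {}"
  shows "d_nw G = 0"
proof -
  have "nw_order G 0 []" using assms by (simp add: nw_order_def)
  then show ?thesis using assms d_nw_le_iff_nw_order[of G 0] by auto
qed

lemma d_nw_le_if_label_order: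
  assumes "pair_digraph G" "label_order k G lab xs"
  shows "d_nw G \<le> k"
  using assms nw_order_if_label_order d_nw_le_iff_nw_order finite_pverts by blast

text \<open>The expression built from an optimal order also shows that some number of labels
  suffices, so the \<open>LEAST\<close> is attained.\<close>

lemma lnlc_graph_d_lnlcw:
  assumes "pair_digraph G" "pverts G \<noteq> {}"
  shows "\<exists>lab. lnlc_graph (d_lnlcw G) G lab" and "d_lnlcw G \<le> Suc (d_nw G)"
proof -
  have ex: "\<exists>lab. lnlc_graph (Suc (d_nw G)) G lab"
    using nw_order_d_nw[OF assms(1)] lnlc_graph_if_nw_order[OF assms] by blast
  then show "\<exists>lab. lnlc_graph (d_lnlcw G) G lab"
    using assms(2) LeastI[of "\<lambda>k. \<exists>lab. lnlc_graph k G lab"] by (simp add: d_lnlcw_def)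
  show "d_lnlcw G \<le> Suc (d_nw G)" using ex assms(2) by (simp add: d_lnlcw_def Least_le)
qed

lemma lcw_graph_d_lcw:
  assumes "pair_digraph G" "pverts G \<noteq> {}"
  shows "\<exists>lab. lcw_graph (d_lcw G) G lab" and "d_lcw G \<le> 2 * Suc (d_lnlcw G)"
proof -
  have ex: "\<exists>lab. lcw_graph (2 * Suc (d_lnlcw G)) G lab"
    using lnlc_graph_d_lnlcw(1)[OF assms] lcw_graph_if_lnlc_graph by blast
  then show "\<exists>lab. lcw_graph (d_lcw G) G lab"
    using assms(2) LeastI[of "\<lambda>k. \<exists>lab. lcw_graph k G lab"] by (simp add: d_lcw_def)
  show "d_lcw G \<le> 2 * Suc (d_lnlcw G)"
    unfolding d_lcw_def using ex assms(2) by (simp only: if_False Least_le)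
qed

lemma decomposition_d_lrw:
  assumes "pair_digraph G" "pverts G \<noteq> {}"
  shows "\<exists>(T :: nat pair_pre_digraph) f. caterpillar T \<and> subcubic T \<and>
      bij_betw f (pverts G) (leaves T) \<and> decomp_width G T f \<le> d_lrw G"
    and "d_lrw G \<le> 4 ^ d_nw G"
proof -
  let ?D = "{(T :: nat pair_pre_digraph, f).
    caterpillar T \<and> subcubic T \<and> bij_betw f (pverts G) (leaves T)}"
  have ex: "\<exists>(T :: nat pair_pre_digraph) f. caterpillar T \<and> subcubic T \<and>
      bij_betw f (pverts G) (leaves T) \<and> decomp_width G T f \<le> 4 ^ d_nw G"
    using nw_order_d_nw[OF assms(1)] decomposition_if_nw_order[OF assms(2)] by blast
  then have "?D \<noteq> {}" by auto
  then have iff: "d_lrw G \<le> k \<longleftrightarrow> (\<exists>(T :: nat pair_pre_digraph) f. caterpillar T \<and> subcubic T \<and>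
      bij_betw f (pverts G) (leaves T) \<and> decomp_width G T f \<le> k)" for k
    using assms(2) INF_nat_le_iff[of ?D "\<lambda>(T, f). decomp_width G T f" k]
    unfolding d_lrw_def by auto
  show "\<exists>(T :: nat pair_pre_digraph) f. caterpillar T \<and> subcubic T \<and>
      bij_betw f (pverts G) (leaves T) \<and> decomp_width G T f \<le> d_lrw G"
    using iff[of "d_lrw G"] by simp
  show "d_lrw G \<le> 4 ^ d_nw G" using iff ex by simp
qed

lemma d_nw_le_power_d_lrw:
  assumes "pair_digraph G" "pverts G \<noteq> {}"
  shows "d_nw G \<le> 4 ^ d_lrw G + 4"
  using decomposition_d_lrw(1)[OF assms] nw_order_if_decomposition[OF finite_pverts[OF assms(1)]]
    d_nw_le_iff_nw_order[OF finite_pverts[OF assms(1)]] by blast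

text \<open>One pair of bounds serves all parameters: \<open>4 ^ d_nw G\<close> and
  \<open>4 ^ \<gamma> G + 4\<close> come from \<open>d_lrw\<close>, while
  \<open>2 * d_nw G + 4\<close> is \<open>2 * Suc (Suc (d_nw G))\<close> from
  \<open>d_lcw\<close>.\<close>

lemma parameter_equivalent_d_nw:
  assumes "\<gamma> \<in> {d_nw, d_lnlcw, d_lcw, d_lrw}" and G: "pair_digraph G"
  shows "\<gamma> G \<le> 4 ^ d_nw G + 2 * d_nw G + 4" "d_nw G \<le> 4 ^ \<gamma> G + 4"
proof -
  have pow: "k \<le> 4 ^ k" for k :: nat
    using less_exp[of k] power_mono[of 2 "4 :: nat" k] by linarith
  have "\<gamma> G \<le> 4 ^ d_nw G + 2 * d_nw G + 4 \<and> d_nw G \<le> 4 ^ \<gamma> G + 4"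
  proof (cases "pverts G = {}")
    case True
    then show ?thesis
      using assms(1) by (auto simp: d_nw_empty d_lnlcw_def d_lcw_def d_lrw_def)
  next
    case False
    have nlc: "d_nw G \<le> d_lnlcw G" "d_lnlcw G \<le> Suc (d_nw G)"
      using lnlc_graph_d_lnlcw[OF G False] lnlc_graph_label_order d_nw_le_if_label_order[OF G]
      by blast+
    have cw: "d_nw G \<le> d_lcw G" "d_lcw G \<le> 2 * Suc (d_lnlcw G)"
      using lcw_graph_d_lcw[OF G False] lcw_graph_label_order d_nw_le_if_label_order[OF G]
      by blast+
    note rw = d_nw_le_power_d_lrw[OF G False] decomposition_d_lrw(2)[OF G False]
    consider "\<gamma> = d_nw" | "\<gamma> = d_lnlcw" | "\<gamma> = d_lcw" | "\<gamma> = d_lrw" using assms(1) by blast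
    then show ?thesis
    proof cases
      case 1
      show ?thesis unfolding 1 using pow[of "d_nw G"] by linarith
    next
      case 2
      show ?thesis unfolding 2 using nlc pow[of "d_nw G"] pow[of "d_lnlcw G"] by linarith
    next
      case 3
      show ?thesis unfolding 3 using cw[unfolded mult_Suc_right] nlc pow[of "d_nw G"] pow[of "d_lcw G"] by linarith
    next
      case 4
      show ?thesis unfolding 4 using rw by linarith
    qed
  qed
  then show "\<gamma> G \<le> 4 ^ d_nw G + 2 * d_nw G + 4" "d_nw G \<le> 4 ^ \<gamma> G + 4" by blast+
qed

theorem theorem5p5:
  fixes \<alpha> \<beta> :: "'a pair_pre_digraph \<Rightarrow> nat"
  assumes "\<alpha> \<in> {d_nw, d_lnlcw, d_lcw, d_lrw}"
    and "\<beta> \<in> {d_nw, d_lnlcw, d_lcw, d_lrw}"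
  shows "\<exists>f1 f2 :: nat \<Rightarrow> nat. \<forall>G :: 'a pair_pre_digraph. pair_digraph G \<longrightarrow>
           \<alpha> G \<le> f1 (\<beta> G) \<and> \<beta> G \<le> f2 (\<alpha> G)"
proof -
  define up :: "nat \<Rightarrow> nat" where "up k = 4 ^ k + 2 * k + 4" for k
  define low :: "nat \<Rightarrow> nat" where "low k = 4 ^ k + 4" for k
  \<comment> \<open>Monotonicity allows the bound on \<open>d_nw\<close> to be substituted into the
    bound by \<open>d_nw\<close>; the composite works in both directions.\<close>
  have "mono up"
    unfolding up_def by (intro monoI add_mono power_increasing mult_le_mono2) simp_all
  have "\<gamma> G \<le> up (low (\<delta> G))"
    if "\<gamma> \<in> {d_nw, d_lnlcw, d_lcw, d_lrw}" "\<delta> \<in> {d_nw, d_lnlcw, d_lcw, d_lrw}" "pair_digraph G"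
    for \<gamma> \<delta> :: "'a pair_pre_digraph \<Rightarrow> nat" and G
  proof -
    have "\<gamma> G \<le> up (d_nw G)"
      using parameter_equivalent_d_nw(1)[OF that(1,3)] by (simp add: up_def)
    also have "\<dots> \<le> up (low (\<delta> G))"
      using parameter_equivalent_d_nw(2)[OF that(2,3)]
      by (intro monoD[OF \<open>mono up\<close>]) (simp add: low_def)
    finally show ?thesis .
  qed
  then show ?thesis using assms by (intro exI[of _ "\<lambda>k. up (low k)"]) blast
qed

end
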